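(* Let $D$ be a period domain of $\mathrm{K3}$-type, and let $\mathbb{P}(\Omega_D^1)^+$ be the open subset of $\mathbb{P}(\Omega_D^1)$ formed by the lines inside $T_D$ on which $\omega_D$ restricts to a positive metric. For all $\eta>0$ there exist open subsets $D_\eta\subset D$ and $D_{1,\eta}\subset\mathbb{P}(\Omega_D^1)^+$ such that (i) for all $\alpha>\beta$, $D_\alpha\subset D_\beta$ and $D_{1,\alpha}\subset D_{1,\beta}$; (ii) $\bigcup_{\eta>0}D_\eta=D$ and $\bigcup_{\eta>0}D_{1,\eta}=\mathbb{P}(\Omega_D^1)^+$; and satisfying the following condition: for every non-constant holomorphic map $f:\mathbb{C}\to D$ such that $f^*\omega_D\geqslant 0$ and for all $\varepsilon>0$, there exist $x_0,x_1\in\mathbb{C}$ such that $f(x_0)\notin D_\varepsilon$ and $f'(x_1)\notin D_{1,\varepsilon}$.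
   Context: Let $H$ be a finite-dimensional real vector space with a non-degenerate symmetric bilinear form $q$ of signature $(3,p)$. The associated period domain of K3-type is $D=\{\sigma\in\mathbb{P}(H_{\mathbb{C}})\mid q(\sigma,\sigma)=0,\ q(\sigma,\overline\sigma)>0\}$, where $\mathbb{P}$ denotes the space of lines. On $\mathcal{O}_{\mathbb{P}(H_{\mathbb{C}})}(-1)|_D$ consider the hermitian metric $h(\sigma,\sigma)=q(\sigma,\overline\sigma)$; the Griffiths–Schmid metric is $\omega_D:=i\Theta(\mathcal{O}_{\mathbb{P}(H_{\mathbb{C}})}(-1)|_D,h)$ (locally $-i\partial\overline\partial\log q(s,\overline s)$ for a local non-vanishing holomorphic section $s$). It is a non-degenerate real $(1,1)$-form, seen as an indefinite (pseudo-Kähler) metric on $D$. $\mathbb{P}(\Omega^1_D)$ is the projectivized bundle of lines inside $T_D$. For a non-constant holomorphic map $f:\mathbb{C}\to D$, $f':\mathbb{C}\to\mathbb{P}(\Omega^1_D)$ denotes its lift, sending $x$ to the line spanned by the derivative of $f$ at $x$ (extended holomorphically across the zeros of $df$). *)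

theory Defs
  imports "HOL-Analysis.Analysis"
begin

section \<open>The quadratic space and its complexification\<close>

text \<open>
  A finite-dimensional real vector space \<open>H\<close> is written as \<^typ>\<open>real^'n\<close> (with an arbitrary bilinear
  form on it), and \<open>H\<close> tensored with the complex numbers as \<^typ>\<open>complex^'n\<close>.
\<close>

definition nondegenerate :: "('a::real_vector \<Rightarrow> 'a \<Rightarrow> real) \<Rightarrow> bool" where
  "nondegenerate q \<longleftrightarrow> (\<forall>x. (\<forall>y. q x y = 0) \<longrightarrow> x = 0)"

definition has_signature :: "('a::euclidean_space \<Rightarrow> 'a \<Rightarrow> real) \<Rightarrow> nat \<Rightarrow> nat \<Rightarrow> bool" where
  "has_signature q a b \<longleftrightarrow>
    (\<exists>P N. subspace P \<and> subspace N \<and> P \<inter> N = {0} \<and> (\<forall>z. \<exists>x\<in>P. \<exists>y\<in>N. z = x + y) \<and>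
       (\<forall>x\<in>P. \<forall>y\<in>N. q x y = 0) \<and>
       (\<forall>x\<in>P - {0}. q x x > 0) \<and> (\<forall>y\<in>N - {0}. q y y < 0) \<and>
       dim P = a \<and> dim N = b)"

definition vRe :: "complex^'n \<Rightarrow> real^'n" where
  "vRe u = (\<chi> i. Re (u $ i))"

definition vIm :: "complex^'n \<Rightarrow> real^'n" where
  "vIm u = (\<chi> i. Im (u $ i))"

definition vcnj :: "complex^'n \<Rightarrow> complex^'n" where
  "vcnj u = (\<chi> i. cnj (u $ i))"

text \<open>The complex bilinear extension of \<open>q\<close>, obtained by expanding \<open>q (a + \<i> b, c + \<i> d)\<close>.\<close>

definition cext :: "(real^'n \<Rightarrow> real^'n \<Rightarrow> real) \<Rightarrow> complex^'n \<Rightarrow> complex^'n \<Rightarrow> complex" where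
  "cext q u v = Complex (q (vRe u) (vRe v) - q (vIm u) (vIm v)) (q (vRe u) (vIm v) + q (vIm u) (vRe v))"

text \<open>\<open>q (s, cnj s)\<close> is automatically a real number if \<open>q\<close> is symmetric.\<close>

definition hmetric :: "(real^'n \<Rightarrow> real^'n \<Rightarrow> real) \<Rightarrow> complex^'n \<Rightarrow> real" where
  "hmetric q s = Re (cext q s (vcnj s))"


section \<open>Projective space and the period domain\<close>

definition quotient_topology :: "'a topology \<Rightarrow> ('a \<Rightarrow> 'b) \<Rightarrow> 'b topology" where
  "quotient_topology X \<pi> =
     topology (\<lambda>U. U \<subseteq> \<pi> ` topspace X \<and> openin X {x \<in> topspace X. \<pi> x \<in> U})"

lemma istopology_quotient:
  "istopology (\<lambda>U. U \<subseteq> \<pi> ` topspace X \<and> openin X {x \<in> topspace X. \<pi> x \<in> U})"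
proof -
  have 1: "{x \<in> topspace X. \<pi> x \<in> S \<inter> T} = {x \<in> topspace X. \<pi> x \<in> S} \<inter> {x \<in> topspace X. \<pi> x \<in> T}" for S T
    by auto
  have 2: "{x \<in> topspace X. \<pi> x \<in> \<Union> K} = (\<Union>S\<in>K. {x \<in> topspace X. \<pi> x \<in> S})" for K
    by auto
  show ?thesis
    unfolding istopology_def 1 2 by (auto intro!: openin_Union)
qed

lemma openin_quotient_topology:
  "openin (quotient_topology X \<pi>) U \<longleftrightarrow> U \<subseteq> \<pi> ` topspace X \<and> openin X {x \<in> topspace X. \<pi> x \<in> U}"
  unfolding quotient_topology_def using istopology_quotient[of \<pi> X] by (simp add: topology_inverse')

definition cline :: "complex^'n \<Rightarrow> (complex^'n) set" where
  "cline s = vec.span {s}"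

definition proj_space :: "(complex^'n) set set" where
  "proj_space = {cline s |s. s \<noteq> 0}"

definition proj_topology :: "(complex^'n) set topology" where
  "proj_topology = quotient_topology (top_of_set (UNIV - {0})) cline"

definition period_domain :: "(real^'n \<Rightarrow> real^'n \<Rightarrow> real) \<Rightarrow> (complex^'n) set set" where
  "period_domain q =
     {\<sigma> \<in> proj_space. \<forall>s\<in>\<sigma> - {0}. cext q s s = 0 \<and> hmetric q s > 0}"

definition period_topology :: "(real^'n \<Rightarrow> real^'n \<Rightarrow> real) \<Rightarrow> (complex^'n) set topology" where
  "period_topology q = subtopology proj_topology (period_domain q)"


section \<open>Tangent vectors\<close>

text \<open>
  The tangent space of projective space at a line \<open>\<sigma>\<close> is \<open>Hom(\<sigma>, H/\<sigma>)\<close> (\<open>H\<close> complexified). A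
  homomorphism is encoded by its graph, i.e. the set of all \<open>(x, y)\<close> with \<open>x\<close> in \<open>\<sigma>\<close> and \<open>y\<close> in the
  coset that is the image of \<open>x\<close>. For \<open>s \<noteq> 0\<close>, \<open>tvec s v\<close> is the homomorphism on the line of \<open>s\<close>
  with \<open>s \<mapsto> v + \<sigma>\<close>; it is the image of the vector \<open>v\<close> at the point \<open>s\<close> under the differential of
  the projection \<open>s \<mapsto> cline s\<close>. It vanishes iff \<open>v \<in> cline s\<close>.
\<close>

type_synonym 'n tangent = "((complex^'n) \<times> (complex^'n)) set"

definition tvec :: "complex^'n \<Rightarrow> complex^'n \<Rightarrow> 'n tangent" where
  "tvec s v = {(c *s s, c *s v + d *s s) |c d. True}"

text \<open>Multiplication by \<open>\<i>\<close> on tangent vectors, \<open>J (tvec s v) = tvec s (\<i> *s v)\<close>.\<close>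

definition cpx_J :: "('n::finite) tangent \<Rightarrow> 'n tangent" where
  "cpx_J \<tau> = (\<lambda>(x, y). (x, \<i> *s y)) ` \<tau>"

text \<open>The complex line spanned by the tangent vector \<open>tvec s v\<close>.\<close>

definition tline :: "complex^'n \<Rightarrow> complex^'n \<Rightarrow> 'n tangent set" where
  "tline s v = {tvec s (c *s v) |c. True}"

text \<open>
  The period domain is open in the smooth quadric \<open>q (s, s) = 0\<close>, so \<open>tvec s v\<close> is tangent to it iff
  \<open>q (s, v) = 0\<close>. The next set consists of all pairs representing a point \<open>s\<close> of the period domain
  together with a non-zero tangent vector \<open>tvec s v\<close> of it.
\<close>

definition tangent_pairs :: "(real^'n \<Rightarrow> real^'n \<Rightarrow> real) \<Rightarrow> ((complex^'n) \<times> (complex^'n)) set" where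
  "tangent_pairs q = {(s, v). s \<noteq> 0 \<and> cline s \<in> period_domain q \<and> cext q s v = 0 \<and> v \<notin> cline s}"

text \<open>
  The bundle of lines in the tangent bundle of the period domain, as a set of lines (the base point
  of a line is determined by it). The map from \<^const>\<open>tangent_pairs\<close> to it is a surjective holomorphic
  submersion, hence the manifold topology is the quotient topology.
\<close>

definition PT :: "(real^'n \<Rightarrow> real^'n \<Rightarrow> real) \<Rightarrow> 'n tangent set set" where
  "PT q = {tline s v |s v. (s, v) \<in> tangent_pairs q}"

definition PT_topology :: "(real^'n \<Rightarrow> real^'n \<Rightarrow> real) \<Rightarrow> 'n tangent set topology" where
  "PT_topology q = quotient_topology (top_of_set (tangent_pairs q)) (\<lambda>(s, v). tline s v)"


section \<open>The Griffiths--Schmid form\<close>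

text \<open>
  Wirtinger derivatives in the direction \<open>u\<close>: with coordinates \<open>z\<^sub>j\<close>, \<open>del\<close> is the sum of all
  \<open>u\<^sub>j \<partial>\<psi>/\<partial>z\<^sub>j\<close> and \<open>delbar\<close> the sum of all \<open>cnj u\<^sub>j \<partial>\<psi>/\<partial>(cnj z\<^sub>j)\<close>.
\<close>

definition del :: "(complex^'n \<Rightarrow> complex) \<Rightarrow> complex^'n \<Rightarrow> complex^'n \<Rightarrow> complex" where
  "del \<psi> z u = (frechet_derivative \<psi> (at z) u - \<i> * frechet_derivative \<psi> (at z) (\<i> *s u)) / 2"

definition delbar :: "(complex^'n \<Rightarrow> complex) \<Rightarrow> complex^'n \<Rightarrow> complex^'n \<Rightarrow> complex" where
  "delbar \<psi> z u = (frechet_derivative \<psi> (at z) u + \<i> * frechet_derivative \<psi> (at z) (\<i> *s u)) / 2"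

text \<open>
  The 2-form \<open>\<partial>\<partial>bar \<psi> = \<Sum> \<partial>\<^sup>2\<psi>/(\<partial>z\<^sub>j \<partial>(cnj z\<^sub>k)) dz\<^sub>j \<and> d(cnj z\<^sub>k)\<close> evaluated on \<open>(u, w)\<close>, with
  \<open>(a \<and> b) (u, w) = a u * b w - a w * b u\<close>.
\<close>

definition deldelbar :: "(complex^'n \<Rightarrow> complex) \<Rightarrow> complex^'n \<Rightarrow> complex^'n \<Rightarrow> complex^'n \<Rightarrow> complex" where
  "deldelbar \<psi> z u w = del (\<lambda>y. delbar \<psi> y w) z u - del (\<lambda>y. delbar \<psi> y u) z w"

text \<open>
  The pull-back of the Griffiths--Schmid form \<open>-\<i> \<partial>\<partial>bar log q (s, cnj s)\<close> to the punctured cone of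
  \<open>s\<close> with \<open>q (s, cnj s) > 0\<close>, where \<open>O(-1)\<close> has the tautological section; the form on the period
  domain is the induced one on tangent vectors (see \<open>GS_form_tvec\<close> for independence of the choices).
\<close>

definition GS_cone :: "(real^'n \<Rightarrow> real^'n \<Rightarrow> real) \<Rightarrow> complex^'n \<Rightarrow> complex^'n \<Rightarrow> complex^'n \<Rightarrow> real" where
  "GS_cone q s u w = Re (- \<i> * deldelbar (\<lambda>z. complex_of_real (ln (hmetric q z))) s u w)"

definition GS_form :: "(real^'n \<Rightarrow> real^'n \<Rightarrow> real) \<Rightarrow> 'n tangent \<Rightarrow> 'n tangent \<Rightarrow> real" where
  "GS_form q \<tau> \<tau>' =
     (THE r. \<exists>s u w. s \<noteq> 0 \<and> \<tau> = tvec s u \<and> \<tau>' = tvec s w \<and> r = GS_cone q s u w)"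

lemma vRe_simps [simp]:
  "vRe (u + v) = vRe u + vRe v" "vIm (u + v) = vIm u + vIm v"
  "vRe (c *s u) = Re c *\<^sub>R vRe u - Im c *\<^sub>R vIm u"
  "vIm (c *s u) = Re c *\<^sub>R vIm u + Im c *\<^sub>R vRe u"
  "vRe (r *\<^sub>R u) = r *\<^sub>R vRe u" "vIm (r *\<^sub>R u) = r *\<^sub>R vIm u"
  "vRe (vcnj u) = vRe u" "vIm (vcnj u) = - vIm u"
  by (simp_all add: vec_eq_iff vRe_def vIm_def vcnj_def)

lemma vcnj_simps [simp]:
  "vcnj (u + v) = vcnj u + vcnj v" "vcnj (c *s u) = cnj c *s vcnj u" "vcnj (r *\<^sub>R u) = r *\<^sub>R vcnj u"
  by (simp_all add: vec_eq_iff vcnj_def)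

context
  fixes q :: "real^'n \<Rightarrow> real^'n \<Rightarrow> real"
  assumes bil: "bilinear q" and sym: "\<And>x y. q x y = q y x"
begin

lemmas bil_simps = bilinear_ladd[OF bil] bilinear_radd[OF bil] bilinear_lmul[OF bil]
  bilinear_rmul[OF bil] bilinear_lsub[OF bil] bilinear_rsub[OF bil] bilinear_lneg[OF bil] bilinear_rneg[OF bil]

lemma cext_simps:
  "cext q (u + v) w = cext q u w + cext q v w"
  "cext q u (v + w) = cext q u v + cext q u w"
  "cext q (c *s u) v = c * cext q u v"
  "cext q u (c *s v) = c * cext q u v"
  by (simp_all add: cext_def complex_eq_iff bil_simps algebra_simps)

lemma cext_cnj: "cext q u (vcnj w) = cnj (cext q w (vcnj u))"
  by (simp add: cext_def complex_eq_iff bil_simps sym)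

lemma of_real_hmetric: "complex_of_real (hmetric q s) = cext q s (vcnj s)"
  by (simp add: hmetric_def cext_def complex_eq_iff bil_simps sym)

lemma bounded_bilinear_cext: "bounded_bilinear (cext q)"
proof -
  have "bilinear (cext q)"
    unfolding bilinear_def
    by (auto intro!: linearI simp: cext_simps(1,2))
       (simp_all add: cext_def complex_eq_iff bil_simps algebra_simps)
  then show ?thesis
    by (simp add: bilinear_conv_bounded_bilinear)
qed

lemma bounded_linear_vcnj: "bounded_linear (vcnj :: complex^'n \<Rightarrow> complex^'n)"
proof -
  have "linear (vcnj :: complex^'n \<Rightarrow> complex^'n)"
    by (rule linearI) simp_all
  then show ?thesis
    by (rule linear_conv_bounded_linear[THEN iffD1])
qed

lemma hmetric_has_derivative:
  "(hmetric q has_derivative (\<lambda>w. 2 * Re (cext q w (vcnj y)))) (at y)"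
proof -
  have "((\<lambda>z. Re (cext q z (vcnj z))) has_derivative
         (\<lambda>w. Re (cext q y (vcnj w) + cext q w (vcnj y)))) (at y)"
    by (intro bounded_linear.has_derivative[OF bounded_linear_Re]
        bounded_bilinear.FDERIV[OF bounded_bilinear_cext]
        bounded_linear.has_derivative[OF bounded_linear_vcnj] has_derivative_ident)
  moreover have "Re (cext q y (vcnj w) + cext q w (vcnj y)) = 2 * Re (cext q w (vcnj y))" for w
    by (subst cext_cnj) simp
  ultimately show ?thesis
    by (simp add: hmetric_def[abs_def])
qed

lemma delbar_ln_hmetric:
  assumes "hmetric q y > 0"
  shows "delbar (\<lambda>z. complex_of_real (ln (hmetric q z))) y w = cext q y (vcnj w) / hmetric q y"
proof -
  have "((\<lambda>z. complex_of_real (ln (hmetric q z))) has_derivative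
        (\<lambda>w. complex_of_real (2 * Re (cext q w (vcnj y)) * inverse (hmetric q y)))) (at y)"
    using assms
    by (intro has_derivative_of_real has_derivative_ln hmetric_has_derivative)
  then have "frechet_derivative (\<lambda>z. complex_of_real (ln (hmetric q z))) (at y) =
        (\<lambda>w. complex_of_real (2 * Re (cext q w (vcnj y)) * inverse (hmetric q y)))"
    by (rule frechet_derivative_at[symmetric])
  then show ?thesis
    unfolding delbar_def
    by (subst cext_cnj) (simp add: complex_eq_iff cext_simps field_simps)
qed

lemma deldelbar_ln_hmetric_aux:
  assumes "hmetric q s > 0"
  shows "del (\<lambda>y. delbar (\<lambda>z. complex_of_real (ln (hmetric q z))) y w) s u =
     cext q u (vcnj w) / hmetric q s - cext q s (vcnj w) * cext q u (vcnj s) / (hmetric q s)\<^sup>2"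
proof -
  define k where "k = cext q s (vcnj w) / (hmetric q s)\<^sup>2"
  define D where "D = (\<lambda>u. cext q u (vcnj w) / hmetric q s - k * complex_of_real (2 * Re (cext q u (vcnj s))))"
  have c: "continuous_on UNIV (hmetric q)"
    by (intro continuous_at_imp_continuous_on ballI has_derivative_continuous[OF hmetric_has_derivative])
  have op: "open {y. hmetric q y > 0}"
    using c by (intro open_Collect_less continuous_on_const)
  have "((\<lambda>y. cext q y (vcnj w) / complex_of_real (hmetric q y)) has_derivative D) (at s)"
    unfolding D_def k_def using assms
    by (auto intro!: derivative_eq_intros hmetric_has_derivative
        bounded_linear.has_derivative[OF bounded_bilinear.bounded_linear_left[OF bounded_bilinear_cext]]
        simp: fun_eq_iff field_simps power2_eq_square)
  then have "((\<lambda>y. delbar (\<lambda>z. complex_of_real (ln (hmetric q z))) y w) has_derivative D) (at s)"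
    by (rule has_derivative_transform_within_open[OF _ op])
       (use assms in \<open>simp_all add: delbar_ln_hmetric\<close>)
  then have "frechet_derivative (\<lambda>y. delbar (\<lambda>z. complex_of_real (ln (hmetric q z))) y w) (at s) = D"
    by (rule frechet_derivative_at[symmetric])
  then have "del (\<lambda>y. delbar (\<lambda>z. complex_of_real (ln (hmetric q z))) y w) s u = (D u - \<i> * D (\<i> *s u)) / 2"
    unfolding del_def by simp
  also have "D u - \<i> * D (\<i> *s u) = 2 * (cext q u (vcnj w) / hmetric q s)
      - k * (of_real (2 * Re (cext q u (vcnj s))) - \<i> * of_real (2 * Re (\<i> * cext q u (vcnj s))))"
    unfolding D_def cext_simps by (simp add: algebra_simps)
  also have "of_real (2 * Re a) - \<i> * of_real (2 * Re (\<i> * a)) = 2 * a" for a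
    by (simp add: complex_eq_iff)
  also have "2 * a - k * (2 * b) = 2 * (a - k * b)" for a b
    by (simp add: right_diff_distrib)
  finally show ?thesis
    by (simp only: nonzero_mult_div_cancel_left zero_neq_numeral[symmetric] not_False_eq_True) (simp add: k_def)
qed

lemma GS_cone_eq:
  assumes "hmetric q s > 0"
  shows "GS_cone q s u w =
     2 * Im (cext q u (vcnj w) / hmetric q s - cext q s (vcnj w) * cext q u (vcnj s) / (hmetric q s)\<^sup>2)"
    (is "_ = 2 * Im ?A")
proof -
  have "cext q w (vcnj u) / hmetric q s - cext q s (vcnj u) * cext q w (vcnj s) / (hmetric q s)\<^sup>2 = cnj ?A"
    by (subst (1 2 3) cext_cnj) (simp add: mult.commute)
  then have "GS_cone q s u w = Re (- \<i> * (?A - cnj ?A))"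
    unfolding GS_cone_def deldelbar_def deldelbar_ln_hmetric_aux[OF assms] by (simp only:)
  moreover have "Re (- \<i> * (a - cnj a)) = 2 * Im a" for a
    by simp
  ultimately show ?thesis
    by (simp only:)
qed

text \<open>\<^const>\<open>GS_form\<close> does not depend on the chosen representatives.\<close>

lemma GS_form_tvec:
  assumes h: "hmetric q s > 0"
  shows "GS_form q (tvec s u) (tvec s w) = GS_cone q s u w"
  unfolding GS_form_def
proof (rule the_equality)
  have "cext q 0 v = 0" for v
    using cext_simps(3)[of 0 0 v] by simp
  then have "s \<noteq> 0"
    using h by (auto simp: hmetric_def)
  then show "\<exists>s' u' w'. s' \<noteq> 0 \<and> tvec s u = tvec s' u' \<and> tvec s w = tvec s' w' \<and>
      GS_cone q s u w = GS_cone q s' u' w'"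
    by blast
next
  fix r assume "\<exists>s' u' w'. s' \<noteq> 0 \<and> tvec s u = tvec s' u' \<and> tvec s w = tvec s' w' \<and> r = GS_cone q s' u' w'"
  then obtain s' u' w' where *: "s' \<noteq> 0" "tvec s u = tvec s' u'" "tvec s w = tvec s' w'"
    and r: "r = GS_cone q s' u' w'" by blast
  have mem: "(x, y) \<in> tvec x y" for x y :: "complex^'n"
    unfolding tvec_def mem_Collect_eq by (rule exI[of _ 1], rule exI[of _ 0]) simp
  have "(s, u) \<in> tvec s' u'" "(s, w) \<in> tvec s' w'"
    using * mem by metis+
  then obtain c d c2 e where "s = c *s s'" "u = c *s u' + d *s s'" "s = c2 *s s'" "w = c2 *s w' + e *s s'"
    unfolding tvec_def by blast
  moreover from this have "c2 = c"
    using \<open>s' \<noteq> 0\<close> by (metis vec.scale_right_imp_eq)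
  ultimately have s: "s = c *s s'" and u: "u = c *s u' + d *s s'" and w: "w = c *s w' + e *s s'"
    by simp_all
  have hs: "complex_of_real (hmetric q s) = c * cnj c * complex_of_real (hmetric q s')"
    by (simp add: of_real_hmetric s cext_simps)
  then have "complex_of_real (hmetric q s) = complex_of_real ((cmod c)\<^sup>2 * hmetric q s')"
    by (simp only: of_real_mult complex_norm_square)
  then have hs_re: "hmetric q s = (cmod c)\<^sup>2 * hmetric q s'"
    by (simp only: of_real_eq_iff)
  then have h': "hmetric q s' > 0" and c: "c \<noteq> 0"
    using h by (auto simp: zero_less_mult_iff)
  have h0: "cext q s' (vcnj s') \<noteq> 0"
    using h' of_real_hmetric[of s'] by (metis less_irrefl of_real_eq_0_iff)
  have alg: "(k * (c * A + d * P) + f * (c * R + d * N)) / (c * k * N)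
      - (c * (k * P + f * N)) * (k * (c * R + d * N)) / (c * k * N)\<^sup>2 = A / N - P * R / N\<^sup>2"
    if "k \<noteq> 0" "N \<noteq> 0" for k f A P R N :: complex
    using that \<open>c \<noteq> 0\<close> by (simp add: divide_simps power2_eq_square) algebra
  have uw: "cext q u (vcnj w) = cnj c * (c * cext q u' (vcnj w') + d * cext q s' (vcnj w'))
      + cnj e * (c * cext q u' (vcnj s') + d * cext q s' (vcnj s'))"
    unfolding u w vcnj_simps cext_simps by (simp add: algebra_simps)
  have sw: "cext q s (vcnj w) = c * (cnj c * cext q s' (vcnj w') + cnj e * cext q s' (vcnj s'))"
    unfolding s w vcnj_simps cext_simps by (simp add: algebra_simps)
  have us: "cext q u (vcnj s) = cnj c * (c * cext q u' (vcnj s') + d * cext q s' (vcnj s'))"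
    unfolding u s vcnj_simps cext_simps by (simp add: algebra_simps)
  have "cext q u (vcnj w) / hmetric q s - cext q s (vcnj w) * cext q u (vcnj s) / (hmetric q s)\<^sup>2 =
    cext q u' (vcnj w') / hmetric q s' - cext q s' (vcnj w') * cext q u' (vcnj s') / (hmetric q s')\<^sup>2"
    unfolding uw sw us of_real_power hs of_real_hmetric[of s'] by (rule alg) (use c h0 in simp_all)
  then show "r = GS_cone q s u w"
    unfolding r GS_cone_eq[OF h] GS_cone_eq[OF h'] by simp
qed

end

lemma cpx_J_tvec: "cpx_J (tvec s v) = tvec s (\<i> *s v)"
proof -
  have "\<exists>d'. \<i> *s (c *s v + d *s s) = c *s (\<i> *s v) + d' *s s"
       "\<exists>d'. c *s (\<i> *s v) + d *s s = \<i> *s (c *s v + d' *s s)" for c d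
    by (rule exI[of _ "\<i> * d"], simp add: vec.scale_right_distrib mult.commute)
       (rule exI[of _ "- \<i> * d"], simp add: vec.scale_right_distrib mult.commute)
  then show ?thesis
    unfolding cpx_J_def tvec_def by (fastforce simp: image_iff)
qed

text \<open>The metric associated with a \<open>(1,1)\<close>-form \<open>\<omega>\<close> is \<open>\<omega> (\<tau>, J \<tau>)\<close>.\<close>

definition PT_plus :: "(real^'n \<Rightarrow> real^'n \<Rightarrow> real) \<Rightarrow> 'n tangent set set" where
  "PT_plus q = {l \<in> PT q. \<forall>s v. tvec s v \<in> l \<and> v \<notin> cline s \<longrightarrow> GS_form q (tvec s v) (cpx_J (tvec s v)) > 0}"


section \<open>Entire curves and their lifts\<close>

definition vholomorphic_on :: "(complex \<Rightarrow> complex^'n) \<Rightarrow> complex set \<Rightarrow> bool" where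
  "vholomorphic_on F U \<longleftrightarrow> (\<forall>i. (\<lambda>z. F z $ i) holomorphic_on U)"

definition vderiv :: "(complex \<Rightarrow> complex^'n) \<Rightarrow> complex \<Rightarrow> complex^'n" where
  "vderiv F x = (\<chi> i. deriv (\<lambda>z. F z $ i) x)"

definition homogeneous_lift :: "(complex \<Rightarrow> (complex^'n) set) \<Rightarrow> complex set \<Rightarrow> (complex \<Rightarrow> complex^'n) \<Rightarrow> bool" where
  "homogeneous_lift f U F \<longleftrightarrow>
     open U \<and> vholomorphic_on F U \<and> (\<forall>z\<in>U. F z \<noteq> 0 \<and> f z = cline (F z))"

text \<open>
  A map into projective space is holomorphic iff it has holomorphic homogeneous coordinates locally.
  The period domain is a locally closed complex submanifold of projective space.
\<close>

definition entire_curve :: "(real^'n \<Rightarrow> real^'n \<Rightarrow> real) \<Rightarrow> (complex \<Rightarrow> (complex^'n) set) \<Rightarrow> bool" where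
  "entire_curve q f \<longleftrightarrow> (\<forall>x. f x \<in> period_domain q) \<and> (\<forall>x. \<exists>U F. x \<in> U \<and> homogeneous_lift f U F)"

text \<open>The differential of \<open>f\<close> at \<open>x\<close> applied to the tangent vector \<open>c\<close> of the complex plane.\<close>

definition differential_at :: "(complex \<Rightarrow> (complex^'n) set) \<Rightarrow> complex \<Rightarrow> complex \<Rightarrow> 'n tangent" where
  "differential_at f x c =
     (THE \<tau>. \<exists>U F. x \<in> U \<and> homogeneous_lift f U F \<and> \<tau> = tvec (F x) (c *s vderiv F x))"

text \<open>
  The pull-back of a \<open>(1,1)\<close>-form to the complex plane is \<open>g dx \<and> dy = (\<i>/2) g dz \<and> d(cnj z)\<close>, where
  \<open>g\<close> is its value on the pair \<open>(1, \<i>)\<close>; it is semi-positive iff \<open>g \<ge> 0\<close>.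
\<close>

definition GS_pullback_nonneg :: "(real^'n \<Rightarrow> real^'n \<Rightarrow> real) \<Rightarrow> (complex \<Rightarrow> (complex^'n) set) \<Rightarrow> bool" where
  "GS_pullback_nonneg q f \<longleftrightarrow>
     (\<forall>x. GS_form q (differential_at f x 1) (differential_at f x \<i>) \<ge> 0)"

definition PT_curve :: "(real^'n \<Rightarrow> real^'n \<Rightarrow> real) \<Rightarrow> (complex \<Rightarrow> 'n tangent set) \<Rightarrow> bool" where
  "PT_curve q g \<longleftrightarrow>
     (\<forall>x. \<exists>U F G. open U \<and> x \<in> U \<and> vholomorphic_on F U \<and> vholomorphic_on G U \<and>
        (\<forall>z\<in>U. (F z, G z) \<in> tangent_pairs q \<and> g z = tline (F z) (G z)))"

text \<open>
  The holomorphic map \<open>f'\<close> that sends each \<open>x\<close> with \<open>df \<noteq> 0\<close> at \<open>x\<close> to the line spanned by the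
  derivative. For non-constant \<open>f\<close> the zeros of \<open>df\<close> are isolated and \<open>f'\<close> is unique.
\<close>

definition curve_lift :: "(real^'n \<Rightarrow> real^'n \<Rightarrow> real) \<Rightarrow> (complex \<Rightarrow> (complex^'n) set) \<Rightarrow> complex \<Rightarrow> 'n tangent set" where
  "curve_lift q f =
     (THE g. PT_curve q g \<and>
        (\<forall>x s v. s \<noteq> 0 \<and> differential_at f x 1 = tvec s v \<and> v \<notin> cline s \<longrightarrow> g x = tline s v))"

end

theory Submission
  imports Defs "HOL-Complex_Analysis.Complex_Analysis"
begin

text \<open>
  For \<open>s\<close> on a line of the period domain put \<open>h(s) = q(s, cnj s) / \<bar>s\<bar>\<^sup>2\<close>, which depends only on the line;
  \<open>D\<^sub>\<eta>\<close> is the set where \<open>h > \<eta>\<close>, and \<open>D\<^sub>1\<^sub>,\<^sub>\<eta>\<close> consists of the positive tangent lines based in it. Along a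
  curve \<open>f\<close> with \<open>f\<^sup>*\<omega> \<ge> 0\<close>, both \<open>ln \<bar>s\<bar>\<^sup>2\<close> and \<open>- ln q(s, cnj s)\<close> are subharmonic in a holomorphic lift \<open>s\<close>, so
  \<open>- ln (h \<circ> f)\<close> is subharmonic on the plane. If \<open>f\<close> stayed in \<open>D\<^sub>\<epsilon>\<close>, this function would be bounded above
  by \<open>- ln \<epsilon>\<close>, hence constant; then the Laplacian of \<open>ln \<bar>s\<bar>\<^sup>2\<close> vanishes, which by the equality case of
  Cauchy--Schwarz makes \<open>f\<close> constant. The lift of \<open>f\<close> leaves \<open>D\<^sub>1\<^sub>,\<^sub>\<epsilon>\<close> at the same point where \<open>f\<close> leaves \<open>D\<^sub>\<epsilon>\<close>.
\<close>

section \<open>Bounded subharmonic functions on the plane\<close>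

text \<open>\<open>c\<close> is the second derivative of \<open>\<phi>\<close> at \<open>z\<close>
  along the real line with direction \<open>\<zeta>\<close>. As a relation it carries existence
  together with the value, and it asks for the second derivative at the single point
  \<open>z\<close> only.\<close>

definition dir_deriv2 :: "(complex \<Rightarrow> real) \<Rightarrow> complex \<Rightarrow> complex \<Rightarrow> real \<Rightarrow> bool" where
  "dir_deriv2 \<phi> z \<zeta> c \<longleftrightarrow>
     (\<exists>g. (\<forall>\<^sub>F t in nhds 0. ((\<lambda>t. \<phi> (z + of_real t * \<zeta>)) has_real_derivative g t) (at t)) \<and>
          (g has_real_derivative c) (at 0))"

definition has_laplacian :: "(complex \<Rightarrow> real) \<Rightarrow> complex \<Rightarrow> real \<Rightarrow> bool" where
  "has_laplacian \<phi> z L \<longleftrightarrow> (\<exists>c d. dir_deriv2 \<phi> z 1 c \<and> dir_deriv2 \<phi> z \<i> d \<and> L = c + d)"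

lemma dir_deriv2_diff:
  assumes "dir_deriv2 \<phi> z \<zeta> c" "dir_deriv2 \<psi> z \<zeta> d"
  shows "dir_deriv2 (\<lambda>z. \<phi> z - \<psi> z) z \<zeta> (c - d)"
proof -
  obtain g h where
    g: "\<forall>\<^sub>F t in nhds 0. ((\<lambda>t. \<phi> (z + of_real t * \<zeta>)) has_real_derivative g t) (at t)"
      "(g has_real_derivative c) (at 0)" and
    h: "\<forall>\<^sub>F t in nhds 0. ((\<lambda>t. \<psi> (z + of_real t * \<zeta>)) has_real_derivative h t) (at t)"
      "(h has_real_derivative d) (at 0)"
    using assms unfolding dir_deriv2_def by blast
  have "\<forall>\<^sub>F t in nhds 0. ((\<lambda>t. \<phi> (z + of_real t * \<zeta>) - \<psi> (z + of_real t * \<zeta>))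
      has_real_derivative g t - h t) (at t)"
    using g(1) h(1) by eventually_elim (rule DERIV_diff)
  moreover have "((\<lambda>t. g t - h t) has_real_derivative c - d) (at 0)"
    using g(2) h(2) by (rule DERIV_diff)
  ultimately show ?thesis
    unfolding dir_deriv2_def by (intro exI[of _ "\<lambda>t. g t - h t"] conjI)
qed

lemma has_laplacian_diff:
  assumes "has_laplacian \<phi> z L" "has_laplacian \<psi> z K"
  shows "has_laplacian (\<lambda>z. \<phi> z - \<psi> z) z (L - K)"
proof -
  obtain a b c d where "dir_deriv2 \<phi> z 1 a" "dir_deriv2 \<phi> z \<i> b" "L = a + b"
      "dir_deriv2 \<psi> z 1 c" "dir_deriv2 \<psi> z \<i> d" "K = c + d"
    using assms unfolding has_laplacian_def by blast
  then show ?thesis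
    unfolding has_laplacian_def
    by (intro exI[of _ "a - c"] exI[of _ "b - d"]) (simp add: dir_deriv2_diff)
qed

lemma dir_deriv2_cong:
  assumes "dir_deriv2 \<phi> z \<zeta> c" "\<forall>\<^sub>F w in nhds z. \<phi> w = \<psi> w"
  shows "dir_deriv2 \<psi> z \<zeta> c"
proof -
  obtain g where
    g: "\<forall>\<^sub>F t in nhds 0. ((\<lambda>t. \<phi> (z + of_real t * \<zeta>)) has_real_derivative g t) (at t)"
      "(g has_real_derivative c) (at 0)"
    using assms(1) unfolding dir_deriv2_def by blast
  have "filterlim (\<lambda>t. z + of_real t * \<zeta>) (nhds z) (nhds (0::real))"
    by (rule tendsto_eq_intros refl filterlim_ident | simp)+
  from assms(2)[THEN eventually_compose_filterlim, OF this]
  have "\<forall>\<^sub>F t in nhds (0::real). \<phi> (z + of_real t * \<zeta>) = \<psi> (z + of_real t * \<zeta>)" .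
  \<comment> \<open>The first derivative at a nearby \<open>t\<close> depends on values around
    \<open>t\<close>, so equality is needed in a neighbourhood of every such
    \<open>t\<close>.\<close>
  then have "\<forall>\<^sub>F t in nhds (0::real). \<forall>\<^sub>F s in nhds t. \<phi> (z + of_real s * \<zeta>) = \<psi> (z + of_real s * \<zeta>)"
    by (simp add: eventually_eventually)
  with g(1) have "\<forall>\<^sub>F t in nhds 0. ((\<lambda>t. \<psi> (z + of_real t * \<zeta>)) has_real_derivative g t) (at t)"
    by eventually_elim (simp add: DERIV_cong_ev[OF refl _ refl])
  with g(2) show ?thesis
    unfolding dir_deriv2_def by blast
qed

lemma has_laplacian_cong:
  assumes "has_laplacian \<phi> z L" "\<forall>\<^sub>F w in nhds z. \<phi> w = \<psi> w"
  shows "has_laplacian \<psi> z L"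
  using assms(1) dir_deriv2_cong[OF _ assms(2)] unfolding has_laplacian_def by blast

text \<open>The second-order chain rule behind both Laplacian computations: \<open>X\<close> will be
  a squared distance, or the value of \<open>hmetric\<close> along a lift with
  \<open>g = ln\<close>. Conditions on \<open>g\<close> are local at \<open>X z\<close>, so the
  logarithm is admissible.\<close>

lemma dir_deriv2_compose:
  fixes g :: "real \<Rightarrow> real"
  assumes X: "\<forall>\<^sub>F t in nhds 0. ((\<lambda>t. X (z + of_real t * \<zeta>)) has_real_derivative X1 t) (at t)"
    and X1: "(X1 has_real_derivative X2) (at 0)"
    and g: "\<forall>\<^sub>F y in nhds (X z). (g has_real_derivative g1 y) (at y)"
    and g1: "(g1 has_real_derivative g2) (at (X z))"
  shows "dir_deriv2 (\<lambda>z. g (X z)) z \<zeta> (g2 * (X1 0)\<^sup>2 + g1 (X z) * X2)"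
proof -
  have X0: "((\<lambda>t. X (z + of_real t * \<zeta>)) has_real_derivative X1 0) (at 0)"
    using X by (rule eventually_nhds_x_imp_x)
  then have "filterlim (\<lambda>t. X (z + of_real t * \<zeta>)) (nhds (X z)) (nhds 0)"
    using DERIV_isCont[OF X0] tendsto_at_iff_tendsto_nhds[of "\<lambda>t. X (z + of_real t * \<zeta>)" 0]
    by (simp add: isCont_def)
  with g have "\<forall>\<^sub>F t in nhds 0. (g has_real_derivative g1 (X (z + of_real t * \<zeta>))) (at (X (z + of_real t * \<zeta>)))"
    by (rule eventually_compose_filterlim)
  with X have "\<forall>\<^sub>F t in nhds 0. ((\<lambda>t. g (X (z + of_real t * \<zeta>))) has_real_derivative
      g1 (X (z + of_real t * \<zeta>)) * X1 t) (at t)"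
    by eventually_elim (rule DERIV_chain2)
  moreover have "((\<lambda>t. g1 (X (z + of_real t * \<zeta>)) * X1 t) has_real_derivative
      (g2 * (X1 0)\<^sup>2 + g1 (X z) * X2)) (at 0)"
  proof -
    have "((\<lambda>t. g1 (X (z + of_real t * \<zeta>))) has_real_derivative g2 * X1 0) (at 0)"
      by (rule DERIV_chain2[OF _ X0]) (simp add: g1)
    from DERIV_mult[OF this X1] show ?thesis
      by (simp add: power2_eq_square algebra_simps)
  qed
  ultimately show ?thesis
    unfolding dir_deriv2_def by (intro exI[of _ "\<lambda>t. g1 (X (z + of_real t * \<zeta>)) * X1 t"] conjI)
qed

text \<open>If \<open>c\<close> were positive, the first derivative \<open>g\<close>, which vanishes
  at the maximum, would be positive just to the right of 0, and the mean value theorem would produce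
  a larger value nearby.\<close>

lemma dir_deriv2_local_max:
  assumes "dir_deriv2 \<phi> z \<zeta> c" and "\<forall>\<^sub>F w in nhds z. \<phi> w \<le> \<phi> z"
  shows "c \<le> 0"
proof (rule ccontr)
  assume "\<not> c \<le> 0"
  then have c: "c > 0" by simp
  define k where "k t = \<phi> (z + of_real t * \<zeta>)" for t
  obtain g where g: "\<forall>\<^sub>F t in nhds 0. (k has_real_derivative g t) (at t)"
      and g': "(g has_real_derivative c) (at 0)"
    using assms(1) unfolding dir_deriv2_def k_def[abs_def] by blast
  have "filterlim (\<lambda>t. z + of_real t * \<zeta>) (nhds z) (nhds (0::real))"
    by (rule tendsto_eq_intros refl filterlim_ident | simp)+
  from assms(2)[THEN eventually_compose_filterlim, OF this]
  have "\<forall>\<^sub>F t in nhds (0::real). k t \<le> k 0"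
    by (simp add: k_def)
  with g have "\<forall>\<^sub>F t in nhds 0. (k has_real_derivative g t) (at t) \<and> k t \<le> k 0"
    by eventually_elim simp
  then obtain d where d: "d > 0" "\<And>t. \<bar>t\<bar> < d \<Longrightarrow> (k has_real_derivative g t) (at t)"
      "\<And>t. \<bar>t\<bar> < d \<Longrightarrow> k t \<le> k 0"
    unfolding eventually_nhds_metric by (auto simp: dist_real_def)
  have g0: "g 0 = 0"
    by (rule DERIV_local_max[OF d(2)[of 0] d(1)]) (use d in auto)
  obtain e where e: "e > 0" "\<And>h. 0 < h \<Longrightarrow> h < e \<Longrightarrow> g 0 < g h"
    using DERIV_pos_inc_right[OF g' c] by auto
  define t where "t = min d e / 2"
  have t: "0 < t" "t < d" "t < e"
    using d(1) e(1) by (auto simp: t_def)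
  obtain s where s: "0 < s" "s < t" "k t - k 0 = (t - 0) * g s"
    using MVT2[of 0 t k g] d(2) t by force
  have "g s > 0"
    using e(2)[of s] s t g0 by simp
  then have "(t - 0) * g s > 0"
    using t by simp
  then show False
    using s(3) d(3)[of t] t by simp
qed

lemma has_laplacian_local_max:
  assumes "has_laplacian \<phi> z L" and "\<forall>\<^sub>F w in nhds z. \<phi> w \<le> \<phi> z"
  shows "L \<le> 0"
proof -
  obtain c d where "dir_deriv2 \<phi> z 1 c" "dir_deriv2 \<phi> z \<i> d" "L = c + d"
    using assms(1) unfolding has_laplacian_def by blast
  with dir_deriv2_local_max assms(2) show ?thesis
    by (metis add_nonpos_nonpos)
qed

text \<open>For X = |z - a|^2 in the plane, the squared gradient is 4 X and the Laplacian is 4, so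
  the chain rule gives 4 (X g'' + g').\<close>

lemma has_laplacian_radial:
  fixes g :: "real \<Rightarrow> real"
  assumes g: "\<forall>\<^sub>F y in nhds ((cmod (z - a))\<^sup>2). (g has_real_derivative g1 y) (at y)"
    and g1: "(g1 has_real_derivative g2) (at ((cmod (z - a))\<^sup>2))"
  shows "has_laplacian (\<lambda>z. g ((cmod (z - a))\<^sup>2)) z
           (4 * (g2 * (cmod (z - a))\<^sup>2 + g1 ((cmod (z - a))\<^sup>2)))"
proof -
  define u where "u = z - a"
  have X: "((\<lambda>t. (cmod (z + of_real t * \<zeta> - a))\<^sup>2) has_real_derivative
          2 * Re (cnj \<zeta> * u) + 2 * t * (cmod \<zeta>)\<^sup>2) (at t)" for t \<zeta>
  proof -
    have "(\<lambda>t. (cmod (z + of_real t * \<zeta> - a))\<^sup>2) =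
        (\<lambda>t. (Re u + t * Re \<zeta>)\<^sup>2 + (Im u + t * Im \<zeta>)\<^sup>2)"
      by (simp add: fun_eq_iff cmod_power2 u_def algebra_simps)
    then show ?thesis
      by (auto intro!: derivative_eq_intros simp: cmod_power2) (simp add: algebra_simps power2_eq_square)
  qed
  have X1: "((\<lambda>t. 2 * Re (cnj \<zeta> * u) + 2 * t * (cmod \<zeta>)\<^sup>2) has_real_derivative
     2 * (cmod \<zeta>)\<^sup>2) (at 0)" for \<zeta>
    by (auto intro!: derivative_eq_intros)
  have *: "dir_deriv2 (\<lambda>z. g ((cmod (z - a))\<^sup>2)) z \<zeta>
     (g2 * (2 * Re (cnj \<zeta> * u) + 2 * 0 * (cmod \<zeta>)\<^sup>2)\<^sup>2 + g1 ((cmod (z - a))\<^sup>2) * (2 * (cmod \<zeta>)\<^sup>2))" for \<zeta>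
    by (rule dir_deriv2_compose[where X = "\<lambda>z. (cmod (z - a))\<^sup>2", OF _ X1 g g1])
      (rule always_eventually allI X)+
  show ?thesis
    unfolding has_laplacian_def
    apply (intro exI conjI, rule *, rule *)
    apply (simp add: cmod_power2 u_def)
    apply (simp add: algebra_simps power2_eq_square)
    done
qed

text \<open>
  The comparison function is \<open>ln X - 1 / X\<close> with \<open>X = \<bar>z - a\<bar>\<^sup>2\<close>: it tends to infinity and its
  Laplacian \<open>- 4 / X\<^sup>2\<close> is strictly negative, so \<open>\<phi>\<close> minus a small multiple of it has no interior
  local maximum.
\<close>

lemma subharmonic_bounded_le:
  fixes \<phi> :: "complex \<Rightarrow> real"
  assumes cont: "continuous_on UNIV \<phi>"
    and lap: "\<And>z. \<exists>L\<ge>0. has_laplacian \<phi> z L"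
    and bd: "\<And>z. \<phi> z \<le> M"
  shows "\<phi> b \<le> \<phi> a"
proof (rule ccontr)
  assume "\<not> \<phi> b \<le> \<phi> a"
  then have less: "\<phi> a < \<phi> b" by simp
  \<comment> \<open>A level strictly between the two values: \<open>\<phi>\<close> stays below it on
    a small disc around \<open>a\<close> and exceeds it at \<open>b\<close>.\<close>
  define m where "m = (\<phi> a + \<phi> b) / 2"
  have m: "\<phi> a < m" "m < \<phi> b"
    using less by (auto simp: m_def)
  have "\<forall>\<^sub>F z in nhds a. \<phi> z < m"
    using cont m(1) unfolding continuous_on_def tendsto_at_iff_tendsto_nhds
    by (auto intro: order_tendstoD(2))
  then obtain r0 where r0: "r0 > 0" "\<And>z. dist z a < r0 \<Longrightarrow> \<phi> z < m"
    unfolding eventually_nhds_metric by blast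
  define r where "r = r0 / 2"
  have r: "r > 0" "\<And>z. dist z a \<le> r \<Longrightarrow> \<phi> z < m"
    using r0 by (auto simp: r_def)
  have rb: "r < dist b a"
    using r(2)[of b] m by (meson less_asym not_le)
  define g where "g X = ln X - 1 / X" for X :: real
  \<comment> \<open>Normalised to vanish on the circle of radius \<open>r\<close>, so that
    subtracting a multiple of \<open>v\<close> changes nothing there.\<close>
  define v where "v z = g ((cmod (z - a))\<^sup>2) - g (r\<^sup>2)" for z
  \<comment> \<open>Small enough that \<open>\<phi> b - \<epsilon> * v b\<close> is still above
    \<open>m\<close>; the summand 1 keeps the denominator positive.\<close>
  define \<epsilon> where "\<epsilon> = (\<phi> b - m) / (2 * (\<bar>v b\<bar> + 1))"
  have \<epsilon>: "\<epsilon> > 0"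
    using m by (auto simp: \<epsilon>_def)
  have "\<epsilon> * v b \<le> \<epsilon> * (\<bar>v b\<bar> + 1)"
    using \<epsilon> by (intro mult_left_mono) auto
  also have "\<dots> = (\<phi> b - m) / 2"
  proof -
    have "\<bar>v b\<bar> + 1 \<noteq> 0" by linarith
    then show ?thesis
      unfolding \<epsilon>_def by (simp add: divide_simps)
  qed
  also have "\<dots> < \<phi> b - m"
    using m by simp
  finally have b_gt: "\<phi> b - \<epsilon> * v b > m"
    by simp
  have "filterlim g at_top at_top"
    unfolding g_def by real_asymp
  then have "\<forall>\<^sub>F X in at_top. g X > (M - m) / \<epsilon> + g (r\<^sup>2)"
    by (simp add: filterlim_at_top_dense)
  then obtain X0 where X0: "\<And>X. X \<ge> X0 \<Longrightarrow> g X > (M - m) / \<epsilon> + g (r\<^sup>2)"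
    unfolding eventually_at_top_linorder by blast
  \<comment> \<open>The outer circle encloses \<open>b\<close> and satisfies
    \<open>R\<^sup>2 \<ge> X0\<close>, so there \<open>\<epsilon> * v\<close> exceeds
    \<open>M - m\<close> and the corrected function falls below \<open>m\<close>.\<close>
  define R where "R = max (dist b a) (max 1 X0) + 1"
  have R: "R > dist b a" "R \<ge> 1" "R \<ge> X0"
    by (auto simp: R_def)
  have "R * 1 \<le> R * R"
    using R(2) by (intro mult_left_mono) auto
  then have R2: "R\<^sup>2 \<ge> X0"
    using R unfolding power2_eq_square by linarith
  define \<psi> where "\<psi> z = \<phi> z - \<epsilon> * v z" for z
  define K where "K = cball a R - ball a r"
  have K: "compact K"
    unfolding K_def by (intro compact_diff compact_cball open_ball)
  have bK: "b \<in> K"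
    using rb R by (auto simp: K_def dist_commute)
  have "continuous_on K v"
    unfolding v_def g_def using r(1)
    by (intro continuous_intros) (auto simp: K_def)
  then have "continuous_on K \<psi>"
    unfolding \<psi>_def
    by (intro continuous_intros continuous_on_subset[OF cont]) auto
  \<comment> \<open>The maximum over the closed annulus is above \<open>m\<close>, while both
    boundary circles only carry values below \<open>m\<close>; hence it is attained in the
    interior.\<close>
  then obtain z where z: "z \<in> K" "\<And>w. w \<in> K \<Longrightarrow> \<psi> w \<le> \<psi> z"
    using continuous_attains_sup[OF K] bK by blast
  have z_gt: "\<psi> z > m"
    using z(2)[OF bK] b_gt by (simp add: \<psi>_def)
  have "dist z a \<noteq> r"
  proof
    assume *: "dist z a = r"
    then have "v z = 0"
      by (simp add: v_def dist_norm)
    then show False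
      using r(2)[of z] z_gt * by (simp add: \<psi>_def)
  qed
  moreover have "dist z a \<noteq> R"
  proof
    assume "dist z a = R"
    then have "v z > (M - m) / \<epsilon>"
      using X0[OF R2] by (simp add: v_def dist_norm)
    then have "\<epsilon> * v z > M - m"
      using \<epsilon> by (simp add: field_simps)
    then show False
      using bd[of z] z_gt by (simp add: \<psi>_def)
  qed
  ultimately have z': "z \<in> ball a R - cball a r"
    using z(1) by (auto simp: K_def dist_commute)
  have "\<forall>\<^sub>F w in nhds z. w \<in> ball a R - cball a r"
    using z' by (intro eventually_nhds_in_open) auto
  then have max: "\<forall>\<^sub>F w in nhds z. \<psi> w \<le> \<psi> z"
    by eventually_elim (rule z(2), auto simp: K_def)
  define X where "X = (cmod (z - a))\<^sup>2"
  have X: "X > 0"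
    using z' r(1) by (auto simp: X_def)
  define G where "G y = \<epsilon> * (g y - g (r\<^sup>2))" for y
  have G1: "(G has_real_derivative \<epsilon> * (1 / y + 1 / y\<^sup>2)) (at y)" if "y > 0" for y
    unfolding G_def g_def using that
    by (auto intro!: derivative_eq_intros simp: field_simps power2_eq_square)
  have "((\<lambda>y. \<epsilon> * (1 / y + 1 / y\<^sup>2)) has_real_derivative \<epsilon> * (- 1 / X\<^sup>2 - 2 / X ^ 3)) (at X)"
    using X by (auto intro!: derivative_eq_intros simp: field_simps power2_eq_square power3_eq_cube)
  moreover have "\<forall>\<^sub>F y in nhds X. (G has_real_derivative \<epsilon> * (1 / y + 1 / y\<^sup>2)) (at y)"
  proof -
    have "\<forall>\<^sub>F y in nhds X. y \<in> {0<..}"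
      using X by (intro eventually_nhds_in_open) auto
    then show ?thesis
      by eventually_elim (use G1 in auto)
  qed
  ultimately have "has_laplacian (\<lambda>z. G ((cmod (z - a))\<^sup>2)) z
      (4 * (\<epsilon> * (- 1 / X\<^sup>2 - 2 / X ^ 3) * X + \<epsilon> * (1 / X + 1 / X\<^sup>2)))"
    unfolding X_def by (intro has_laplacian_radial)
  \<comment> \<open>The contributions of \<open>ln\<close> cancel, since ln |z - a|^2 is harmonic;
    what remains comes from \<open>- 1 / X\<close>.\<close>
  moreover have "4 * (\<epsilon> * (- 1 / X\<^sup>2 - 2 / X ^ 3) * X + \<epsilon> * (1 / X + 1 / X\<^sup>2)) = - (4 * \<epsilon> / X\<^sup>2)"
    using X by (simp add: field_simps power2_eq_square power3_eq_cube)
  moreover have "(\<lambda>z. G ((cmod (z - a))\<^sup>2)) = (\<lambda>z. \<epsilon> * v z)"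
    by (simp add: G_def v_def)
  ultimately have lv: "has_laplacian (\<lambda>z. \<epsilon> * v z) z (- (4 * \<epsilon> / X\<^sup>2))"
    by simp
  obtain L where L: "L \<ge> 0" "has_laplacian \<phi> z L"
    using lap by blast
  have "has_laplacian \<psi> z (L - - (4 * \<epsilon> / X\<^sup>2))"
    unfolding \<psi>_def by (rule has_laplacian_diff[OF L(2) lv])
  from has_laplacian_local_max[OF this max]
  have "L + 4 * \<epsilon> / X\<^sup>2 \<le> 0"
    by simp
  moreover have "4 * \<epsilon> / X\<^sup>2 > 0"
    using X \<epsilon> by simp
  ultimately show False
    using L(1) by linarith
qed

lemma dir_deriv2_unique:
  assumes "dir_deriv2 \<phi> z \<zeta> c" "dir_deriv2 \<phi> z \<zeta> d"
  shows "c = d"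
proof -
  obtain g h where
    g: "\<forall>\<^sub>F t in nhds 0. ((\<lambda>t. \<phi> (z + of_real t * \<zeta>)) has_real_derivative g t) (at t)"
      "(g has_real_derivative c) (at 0)" and
    h: "\<forall>\<^sub>F t in nhds 0. ((\<lambda>t. \<phi> (z + of_real t * \<zeta>)) has_real_derivative h t) (at t)"
      "(h has_real_derivative d) (at 0)"
    using assms unfolding dir_deriv2_def by blast
  have "\<forall>\<^sub>F t in nhds 0. g t = h t"
    using g(1) h(1) by eventually_elim (rule DERIV_unique)
  then have "(g has_real_derivative d) (at 0)"
    using h(2) by (simp add: DERIV_cong_ev[OF refl _ refl])
  with g(2) show ?thesis
    by (rule DERIV_unique)
qed

text \<open>Using the comparison in both directions makes \<open>\<phi>\<close> constant, a
  Liouville theorem; uniqueness of second derivatives then identifies \<open>L\<close> with the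
  Laplacian of a constant.\<close>

lemma subharmonic_bounded_laplacian_zero:
  fixes \<phi> :: "complex \<Rightarrow> real"
  assumes "continuous_on UNIV \<phi>"
    and "\<And>z. \<exists>L\<ge>0. has_laplacian \<phi> z L"
    and "\<And>z. \<phi> z \<le> M"
    and "has_laplacian \<phi> z L"
  shows "L = 0"
proof -
  have "\<phi> a = \<phi> 0" for a
    by (intro order_antisym subharmonic_bounded_le[OF assms(1-3)])
  then have *: "(\<lambda>_. \<phi> 0) = \<phi>"
    by (metis ext)
  have "dir_deriv2 (\<lambda>_. \<phi> 0) z \<zeta> 0" for \<zeta>
    unfolding dir_deriv2_def by (auto intro!: exI[of _ "\<lambda>_. 0"])
  then have "dir_deriv2 \<phi> z \<zeta> 0" for \<zeta>
    unfolding * .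
  then show ?thesis
    using assms(4) dir_deriv2_unique[of \<phi> z] unfolding has_laplacian_def by (metis add_0)
qed

section \<open>Lines and tangent lines\<close>

lemma mem_cline_iff: "x \<in> cline s \<longleftrightarrow> (\<exists>c. x = c *s s)"
  unfolding cline_def by (auto simp: vec.span_singleton)

lemma cline_self [simp]: "s \<in> cline s"
  unfolding mem_cline_iff by (rule exI[of _ 1]) simp

lemma cline_scale:
  assumes "c \<noteq> 0"
  shows "cline (c *s s) = cline s"
proof -
  have "a *s s = (a / c) *s (c *s s)" for a
    using assms by simp
  moreover have "a *s (c *s s) = (a * c) *s s" for a
    by simp
  ultimately show ?thesis
    unfolding set_eq_iff mem_cline_iff by metis
qed

lemma cline_eqD:
  assumes "cline s = cline s'" "s \<noteq> 0"
  obtains c where "c \<noteq> 0" "s = c *s s'"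
proof -
  obtain c where "s = c *s s'"
    using assms(1) cline_self[of s] mem_cline_iff by metis
  with assms(2) that show ?thesis
    by (cases "c = 0") auto
qed

lemma mem_tvec: "(s, v) \<in> tvec s v"
  unfolding tvec_def mem_Collect_eq by (rule exI[of _ 1], rule exI[of _ 0]) simp

text \<open>A homomorphism from the line of \<open>s\<close> to the quotient ignores a common
  rescaling of \<open>s\<close> and its image, and a shift of the image along the line. By
  \<open>tvec_eqD\<close> this is the only ambiguity.\<close>

lemma tvec_change:
  assumes "c \<noteq> 0"
  shows "tvec (c *s s) (c *s v + d *s s) = tvec s v"
proof (intro set_eqI iffI)
  fix p assume "p \<in> tvec (c *s s) (c *s v + d *s s)"
  then obtain a b where "p = (a *s (c *s s), a *s (c *s v + d *s s) + b *s (c *s s))"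
    unfolding tvec_def by blast
  then have "p = ((a * c) *s s, (a * c) *s v + (a * d + b * c) *s s)"
    by (simp add: vec.scale_right_distrib vec.scale_left_distrib algebra_simps)
  then show "p \<in> tvec s v"
    unfolding tvec_def by blast
next
  fix p assume "p \<in> tvec s v"
  then obtain a b where "p = (a *s s, a *s v + b *s s)"
    unfolding tvec_def by blast
  then have "p = ((a / c) *s (c *s s), (a / c) *s (c *s v + d *s s) + ((b - a / c * d) / c) *s (c *s s))"
    using assms by (simp add: vec.scale_right_distrib vec.scale_left_diff_distrib)
  then show "p \<in> tvec (c *s s) (c *s v + d *s s)"
    unfolding tvec_def by blast
qed

lemma tvec_eqD:
  assumes "tvec s v = tvec s' v'" "s \<noteq> 0"
  obtains c d where "c \<noteq> 0" "s = c *s s'" "v = c *s v' + d *s s'"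
proof -
  have "(s, v) \<in> tvec s' v'"
    using mem_tvec assms(1) by metis
  then obtain c d where "s = c *s s'" "v = c *s v' + d *s s'"
    unfolding tvec_def by blast
  with assms(2) that show ?thesis
    by (cases "c = 0") auto
qed

text \<open>For lines of tangent vectors, unlike for single vectors, the factors of \<open>s\<close>
  and \<open>v\<close> are independent.\<close>

lemma tline_change:
  assumes "c \<noteq> 0" "a \<noteq> 0"
  shows "tline (c *s s) (a *s v + d *s s) = tline s v"
proof -
  have *: "tvec (c *s s) (b *s (a *s v + d *s s)) = tvec s ((b * a / c) *s v)" for b
  proof -
    have "b *s (a *s v + d *s s) = c *s ((b * a / c) *s v) + (b * d) *s s"
      using assms by (simp add: vec.scale_right_distrib)
    then show ?thesis
      using tvec_change[OF assms(1), of s "(b * a / c) *s v" "b * d"] by (simp only:)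
  qed
  have "\<exists>b'. b = b' * a / c" for b
    using assms by (intro exI[of _ "b * c / a"]) simp
  then have "range (\<lambda>b. tvec s ((b * a / c) *s v)) = range (\<lambda>b. tvec s (b *s v))"
    by (auto simp: image_iff) metis
  moreover have "tline s v = range (\<lambda>b. tvec s (b *s v))" for s v :: "complex^'a"
    unfolding tline_def by auto
  ultimately show ?thesis
    by (simp only: *)
qed

lemma tline_eqD:
  assumes "tline s v = tline s' v'" "s \<noteq> 0"
  obtains c a d where "c \<noteq> 0" "s = c *s s'" "v = a *s v' + d *s s'"
proof -
  have "tvec s v \<in> tline s v"
    unfolding tline_def mem_Collect_eq by (rule exI[of _ 1]) simp
  then obtain b where b: "tvec s v = tvec s' (b *s v')"
    unfolding assms(1) unfolding tline_def by blast
  show ?thesis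
    by (rule tvec_eqD[OF b assms(2)]) (rule that, auto)
qed

lemma tline_eq_imp_cline_eq:
  assumes "tline s v = tline s' v'" "s \<noteq> 0"
  shows "cline s = cline s'"
  using tline_eqD[OF assms] cline_scale by metis


section \<open>Holomorphic lifts of curves\<close>

lemma vholomorphic_on_subset: "vholomorphic_on F U \<Longrightarrow> V \<subseteq> U \<Longrightarrow> vholomorphic_on F V"
  unfolding vholomorphic_on_def using holomorphic_on_subset by blast

lemma vholomorphic_on_vderiv: "vholomorphic_on F U \<Longrightarrow> open U \<Longrightarrow> vholomorphic_on (vderiv F) U"
  unfolding vholomorphic_on_def vderiv_def by (auto intro: holomorphic_deriv)

lemma vholomorphic_component_deriv:
  assumes "vholomorphic_on F U" "open U" "z \<in> U"
  shows "((\<lambda>z. F z $ i) has_field_derivative vderiv F z $ i) (at z)"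
  using assms unfolding vholomorphic_on_def vderiv_def by (auto intro: holomorphic_derivI)

text \<open>A vector is the finite sum of its coordinate parts, each a bounded linear image of one
  component.\<close>

lemma vec_has_vector_derivative:
  fixes G :: "real \<Rightarrow> complex^'n"
  assumes "\<And>i. ((\<lambda>t. G t $ i) has_vector_derivative G' $ i) (at t)"
  shows "(G has_vector_derivative G') (at t)"
proof -
  have lin: "bounded_linear (\<lambda>x. axis i x :: complex^'n)" for i :: 'n
    by (intro linear_conv_bounded_linear[THEN iffD1] linearI) (auto simp: vec_eq_iff axis_def)
  have sum: "v = (\<Sum>i\<in>UNIV. axis i (v $ i))" for v :: "complex^'n"
    by (simp add: vec_eq_iff axis_def sum.delta' if_distrib cong: if_cong)
  have "((\<lambda>t. \<Sum>i\<in>UNIV. axis i (G t $ i)) has_vector_derivative (\<Sum>i\<in>UNIV. axis i (G' $ i))) (at t)"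
    by (intro has_vector_derivative_sum bounded_linear.has_vector_derivative[OF lin] assms)
  then show ?thesis
    by (simp only: sum[symmetric])
qed

text \<open>Restricts a holomorphic map to a real line, the setting of \<open>dir_deriv2\<close>;
  the chain rule contributes the complex factor \<open>\<zeta>\<close>.\<close>

lemma vholomorphic_line_derivative:
  assumes "vholomorphic_on F U" "open U" "z + of_real t * \<zeta> \<in> U"
  shows "((\<lambda>t. F (z + of_real t * \<zeta>)) has_vector_derivative \<zeta> *s vderiv F (z + of_real t * \<zeta>)) (at t)"
proof (rule vec_has_vector_derivative)
  fix i
  have "((\<lambda>t. z + of_real t * \<zeta>) has_vector_derivative \<zeta>) (at t)"
    by (auto intro!: derivative_eq_intros)
  from field_vector_diff_chain_at[OF this vholomorphic_component_deriv[OF assms]]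
  show "((\<lambda>t. F (z + of_real t * \<zeta>) $ i) has_vector_derivative
      (\<zeta> *s vderiv F (z + of_real t * \<zeta>)) $ i) (at t)"
    by (simp add: o_def)
qed

section \<open>Laplacian of the logarithm of a hermitian form along a holomorphic curve\<close>

context
  fixes q :: "real^'n \<Rightarrow> real^'n \<Rightarrow> real"
  assumes bil: "bilinear q" and sym: "\<And>x y. q x y = q y x"
begin

lemmas cext_rules = cext_simps[OF bil sym]

lemma Re_cext_vcnj: "Re (cext q u (vcnj w)) = Re (cext q w (vcnj u))"
  by (subst cext_cnj[OF bil sym]) simp

lemma hmetric_scale: "hmetric q (c *s s) = (cmod c)\<^sup>2 * hmetric q s"
  unfolding hmetric_def vcnj_simps cext_rules
  by (simp add: cmod_power2) (simp add: algebra_simps power2_eq_square)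

lemma Re_cext_vcnj_derivative:
  assumes "(A has_vector_derivative A') (at t)" "(B has_vector_derivative B') (at t)"
  shows "((\<lambda>t. Re (cext q (A t) (vcnj (B t)))) has_real_derivative
      Re (cext q (A t) (vcnj B')) + Re (cext q A' (vcnj (B t)))) (at t)"
proof -
  have "((\<lambda>t. vcnj (B t)) has_vector_derivative vcnj B') (at t)"
    by (rule bounded_linear.has_vector_derivative[OF bounded_linear_vcnj[OF bil sym] assms(2)])
  from bounded_bilinear.has_vector_derivative[OF bounded_bilinear_cext[OF bil sym] assms(1) this]
  have "((\<lambda>t. Re (cext q (A t) (vcnj (B t)))) has_vector_derivative
      Re (cext q (A t) (vcnj B') + cext q A' (vcnj (B t)))) (at t)"
    by (rule bounded_linear.has_vector_derivative[OF bounded_linear_Re])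
  then show ?thesis
    by (simp add: has_real_derivative_iff_has_vector_derivative)
qed

text \<open>With m the pairing of F' and F, the first derivative of \<open>hmetric\<close> in
  direction \<open>\<zeta>\<close> is 2 Re (\<open>\<zeta>\<close> m). Over the directions 1 and
  \<open>\<i>\<close> the squares of these add up to 4 |m|^2, and the terms with F'' cancel because
  \<open>\<zeta>\<close> squared is 1 and -1.\<close>

lemma has_laplacian_ln_hmetric:
  assumes F: "vholomorphic_on F U" and U: "open U" and z: "z \<in> U" and pos: "hmetric q (F z) > 0"
  shows "has_laplacian (\<lambda>z. ln (hmetric q (F z))) z
    (4 * (hmetric q (vderiv F z) / hmetric q (F z) -
       (cmod (cext q (vderiv F z) (vcnj (F z))))\<^sup>2 / (hmetric q (F z))\<^sup>2))"
proof -
  let ?N = "hmetric q (F z)" and ?m = "cext q (vderiv F z) (vcnj (F z))"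
    and ?w = "cext q (vderiv (vderiv F) z) (vcnj (F z))"
  let ?X1 = "\<lambda>\<zeta> t. 2 * Re (cext q (\<zeta> *s vderiv F (z + of_real t * \<zeta>)) (vcnj (F (z + of_real t * \<zeta>))))"
  let ?X2 = "\<lambda>\<zeta>. 2 * ((cmod \<zeta>)\<^sup>2 * hmetric q (vderiv F z) + Re (\<zeta> * \<zeta> * ?w))"
  have F': "vholomorphic_on (vderiv F) U"
    using F U by (rule vholomorphic_on_vderiv)
  have *: "dir_deriv2 (\<lambda>z. ln (hmetric q (F z))) z \<zeta>
      (- (1 / ?N\<^sup>2) * (?X1 \<zeta> 0)\<^sup>2 + 1 / ?N * ?X2 \<zeta>)" for \<zeta>
  proof (rule dir_deriv2_compose[where X = "\<lambda>z. hmetric q (F z)"])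
    have "filterlim (\<lambda>t. z + of_real t * \<zeta>) (nhds z) (nhds (0::real))"
      by (rule tendsto_eq_intros refl filterlim_ident | simp)+
    with eventually_nhds_in_open[OF U z] have "\<forall>\<^sub>F t in nhds (0::real). z + of_real t * \<zeta> \<in> U"
      by (rule eventually_compose_filterlim)
    then show "\<forall>\<^sub>F t in nhds 0. ((\<lambda>t. hmetric q (F (z + of_real t * \<zeta>))) has_real_derivative ?X1 \<zeta> t) (at t)"
    proof eventually_elim
      case (elim t)
      note D = vholomorphic_line_derivative[OF F U elim]
      from Re_cext_vcnj_derivative[OF D D] show ?case
        by (subst (asm) (2) Re_cext_vcnj) (simp add: hmetric_def)
    qed
    have "((\<lambda>t. Re (cext q (\<zeta> *s vderiv F (z + of_real t * \<zeta>)) (vcnj (F (z + of_real t * \<zeta>)))))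
        has_real_derivative (cmod \<zeta>)\<^sup>2 * hmetric q (vderiv F z) + Re (\<zeta> * \<zeta> * ?w)) (at 0)"
    proof -
      have z0: "z + of_real 0 * \<zeta> \<in> U"
        using z by simp
      have lin: "bounded_linear ((*s) \<zeta> :: complex^'n \<Rightarrow> complex^'n)"
        by (intro linear_conv_bounded_linear[THEN iffD1] linearI)
           (auto simp: vec_eq_iff algebra_simps)
      from Re_cext_vcnj_derivative[OF
          bounded_linear.has_vector_derivative[OF lin vholomorphic_line_derivative[OF F' U z0]]
          vholomorphic_line_derivative[OF F U z0]]
      show ?thesis
        by (simp add: hmetric_scale[symmetric] cext_rules mult.assoc)
           (simp add: hmetric_def cext_rules mult.assoc)
    qed
    from DERIV_cmult[OF this, of 2]
    show "(?X1 \<zeta> has_real_derivative ?X2 \<zeta>) (at 0)"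
      by simp
    have "\<forall>\<^sub>F y in nhds ?N. y \<in> {0<..}"
      using pos by (intro eventually_nhds_in_open) auto
    then show "\<forall>\<^sub>F y in nhds ?N. (ln has_real_derivative 1 / y) (at y)"
      by eventually_elim (auto intro!: derivative_eq_intros)
    show "((\<lambda>y. 1 / y) has_real_derivative - (1 / ?N\<^sup>2)) (at ?N)"
      using pos by (auto intro!: derivative_eq_intros simp: power2_eq_square)
  qed
  show ?thesis
    unfolding has_laplacian_def
    apply (intro exI conjI, rule *, rule *)
    apply (simp add: cext_rules cmod_power2)
    apply (simp add: algebra_simps power2_eq_square add_divide_distrib diff_divide_distrib)
    done
qed

text \<open>Pythagoras for the hermitian form: the subtracted multiple of \<open>s\<close> is the
  orthogonal projection of \<open>v\<close>. Divided by \<open>hmetric q s\<close>, the right-hand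
  side is the Laplacian of \<open>has_laplacian_ln_hmetric\<close> up to the factor 4.\<close>

lemma hmetric_orthogonal_part:
  assumes "hmetric q s > 0"
  shows "hmetric q (v - (cext q v (vcnj s) / hmetric q s) *s s) =
     hmetric q v - (cmod (cext q v (vcnj s)))\<^sup>2 / hmetric q s"
proof -
  let ?m = "cext q v (vcnj s)" and ?N = "complex_of_real (hmetric q s)"
  let ?c = "- (?m / ?N)"
  have N: "?N \<noteq> 0"
    using assms by simp
  have N': "cext q s (vcnj s) = ?N"
    by (simp add: of_real_hmetric[OF bil sym])
  have sv: "cext q s (vcnj v) = cnj ?m"
    by (rule cext_cnj[OF bil sym])
  have "complex_of_real (hmetric q (v + ?c *s s)) =
     cext q v (vcnj v) + cnj ?c * ?m + ?c * (cnj ?m + cnj ?c * ?N)"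
    unfolding of_real_hmetric[OF bil sym, of "v + ?c *s s"] vcnj_simps cext_rules sv N'
    by (simp add: algebra_simps)
  also have "\<dots> = cext q v (vcnj v) - ?m * cnj ?m / ?N"
    using N by (simp add: field_simps)
  also have "\<dots> = complex_of_real (hmetric q v - (cmod ?m)\<^sup>2 / hmetric q s)"
    by (simp add: of_real_hmetric[OF bil sym] complex_norm_square del: of_real_power)
  finally have "hmetric q (v + ?c *s s) = hmetric q v - (cmod ?m)\<^sup>2 / hmetric q s"
    by (simp only: of_real_eq_iff)
  then show ?thesis
    by (simp add: vec.scale_minus_left)
qed

text \<open>Relates the form to the Laplacian with a negative factor: where the form is non-negative
  on the pair, the logarithm of \<open>hmetric q\<close> along a lift has non-positive
  Laplacian.\<close>

lemma GS_cone_J: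
  assumes "hmetric q s > 0"
  shows "GS_cone q s v (\<i> *s v) =
    - 2 * (hmetric q v / hmetric q s - (cmod (cext q v (vcnj s)))\<^sup>2 / (hmetric q s)\<^sup>2)"
proof -
  let ?m = "cext q v (vcnj s)"
  have sv: "cext q s (vcnj v) = cnj ?m"
    by (rule cext_cnj[OF bil sym])
  have "cext q v (vcnj (\<i> *s v)) / hmetric q s - cext q s (vcnj (\<i> *s v)) * ?m / (hmetric q s)\<^sup>2
     = - \<i> * (cext q v (vcnj v) / hmetric q s - ?m * cnj ?m / (hmetric q s)\<^sup>2)"
    unfolding vcnj_simps cext_rules sv by (simp add: algebra_simps)
  also have "\<dots> = - \<i> * complex_of_real (hmetric q v / hmetric q s - (cmod ?m)\<^sup>2 / (hmetric q s)\<^sup>2)"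
    by (simp add: of_real_hmetric[OF bil sym, symmetric] complex_norm_square[symmetric])
  finally show ?thesis
    unfolding GS_cone_eq[OF bil sym assms] by simp
qed

end

text \<open>Makes the standard inner product a second instance of the formulas for \<open>q\<close>.
  Its \<open>hmetric\<close> is the squared hermitian norm, which yields the Fubini-Study side of
  the argument.\<close>

lemma bilinear_inner: "bilinear (inner :: 'a::real_inner \<Rightarrow> _)"
  unfolding bilinear_def by (auto intro!: linearI simp: inner_add_left inner_add_right)

lemma hmetric_inner_pos:
  assumes "s \<noteq> 0"
  shows "hmetric inner s > 0"
proof -
  have "vRe s \<noteq> 0 \<or> vIm s \<noteq> 0"
    using assms by (auto simp: vec_eq_iff vRe_def vIm_def complex_eq_iff)
  moreover have "hmetric inner s = vRe s \<bullet> vRe s + vIm s \<bullet> vIm s"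
    by (simp add: hmetric_def cext_def)
  ultimately show ?thesis
    by (auto simp: add_pos_nonneg add_nonneg_pos)
qed

text \<open>The equality case of Cauchy-Schwarz: times \<open>hmetric inner s\<close>, the
  expression is the squared norm of the part of \<open>v\<close> orthogonal to
  \<open>s\<close>.\<close>

lemma hmetric_inner_orthogonal_part_eq_0:
  fixes s v :: "complex^'n"
  assumes "s \<noteq> 0"
    and "hmetric inner v / hmetric inner s - (cmod (cext inner v (vcnj s)))\<^sup>2 / (hmetric inner s)\<^sup>2 = 0"
  shows "v \<in> cline s"
proof -
  let ?c = "cext inner v (vcnj s) / hmetric inner s"
  have pos: "hmetric inner s > 0"
    using assms(1) by (rule hmetric_inner_pos)
  have "hmetric inner (v - ?c *s s) = 0"
    using assms(2) pos hmetric_orthogonal_part[OF bilinear_inner inner_commute pos, of v]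
    by (simp add: field_simps power2_eq_square)
  then have "v = ?c *s s"
    using hmetric_inner_pos[of "v - ?c *s s"] by auto
  then show ?thesis
    unfolding mem_cline_iff by blast
qed

lemma hmetric_inner_orthogonal_part_nonneg:
  fixes s v :: "complex^'n"
  assumes "s \<noteq> 0"
  shows "hmetric inner v / hmetric inner s - (cmod (cext inner v (vcnj s)))\<^sup>2 / (hmetric inner s)\<^sup>2 \<ge> 0"
proof -
  let ?c = "cext inner v (vcnj s) / hmetric inner s"
  have pos: "hmetric inner s > 0"
    using assms(1) by (rule hmetric_inner_pos)
  have "hmetric inner (v - ?c *s s) \<ge> 0"
    using hmetric_inner_pos[of "v - ?c *s s"]
    by (cases "v - ?c *s s = 0") (simp_all add: hmetric_def cext_def vRe_def vIm_def vcnj_def inner_vec_def)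
  then have "hmetric inner (v - ?c *s s) / hmetric inner s \<ge> 0"
    using pos by simp
  then show ?thesis
    unfolding hmetric_orthogonal_part[OF bilinear_inner inner_commute pos]
    by (simp add: diff_divide_distrib power2_eq_square)
qed

text \<open>Two lifts differ by a scalar function. Instead of constructing it as a holomorphic
  function, the proof differentiates the cross-multiplied identity between the coordinates of
  \<open>F\<close> and \<open>G\<close>.\<close>

lemma homogeneous_lift_change:
  assumes F: "homogeneous_lift f U F" and G: "homogeneous_lift f V G" and x: "x \<in> U" "x \<in> V"
  obtains c d where "c \<noteq> 0" "G x = c *s F x" "vderiv G x = c *s vderiv F x + d *s F x"
proof -
  have U: "open U" "vholomorphic_on F U" and V: "open V" "vholomorphic_on G V"
    using F G by (auto simp: homogeneous_lift_def)
  have lines: "F z \<noteq> 0" "G z \<noteq> 0" "cline (G z) = cline (F z)" if "z \<in> U \<inter> V" for z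
    using F G that by (auto simp: homogeneous_lift_def)
  obtain c where c: "c \<noteq> 0" "G x = c *s F x"
    using lines(2,3)[of x] x by (auto elim: cline_eqD)
  obtain i where i: "F x $ i \<noteq> 0"
    using lines(1)[of x] x by (auto simp: vec_eq_iff)
  have eq: "G z $ i * F z $ j = F z $ i * G z $ j" if z: "z \<in> U \<inter> V" for z j
  proof -
    obtain b where "G z = b *s F z"
      using lines(2,3)[OF z] by (auto elim: cline_eqD)
    then show ?thesis by simp
  qed
  \<comment> \<open>Forced by the coordinate \<open>i\<close>; the differentiated identity then
    gives all other coordinates.\<close>
  define d where "d = (vderiv G x $ i - c * vderiv F x $ i) / F x $ i"
  have "vderiv G x $ j = (c *s vderiv F x + d *s F x) $ j" for j
  proof -
    note D = vholomorphic_component_deriv[OF U(2,1) x(1)] vholomorphic_component_deriv[OF V(2,1) x(2)]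
    have 1: "((\<lambda>z. G z $ i * F z $ j) has_field_derivative
        vderiv G x $ i * F x $ j + vderiv F x $ j * G x $ i) (at x)"
      by (intro DERIV_mult D)
    have 2: "((\<lambda>z. F z $ i * G z $ j) has_field_derivative
        vderiv F x $ i * G x $ j + vderiv G x $ j * F x $ i) (at x)"
      by (intro DERIV_mult D)
    have "\<forall>\<^sub>F z in nhds x. z \<in> U \<inter> V"
      using U V x by (intro eventually_nhds_in_open) auto
    then have "\<forall>\<^sub>F z in nhds x. G z $ i * F z $ j = F z $ i * G z $ j"
      by eventually_elim (rule eq)
    with 1 have "((\<lambda>z. F z $ i * G z $ j) has_field_derivative
        vderiv G x $ i * F x $ j + vderiv F x $ j * G x $ i) (at x)"
      using DERIV_cong_ev[OF refl _ refl] by fast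
    from DERIV_unique[OF this 2] show ?thesis
      using i by (simp add: c d_def field_simps)
  qed
  then have "vderiv G x = c *s vderiv F x + d *s F x"
    by (simp add: vec_eq_iff)
  with c that show ?thesis by blast
qed

text \<open>The definite description is well defined because a change of lift alters the
  representing pair only in the way that \<open>tvec_change\<close> ignores.\<close>

lemma differential_at_eq:
  assumes "homogeneous_lift f U F" "x \<in> U"
  shows "differential_at f x c = tvec (F x) (c *s vderiv F x)"
  unfolding differential_at_def
proof (rule the_equality)
  show "\<exists>U' F'. x \<in> U' \<and> homogeneous_lift f U' F' \<and> tvec (F x) (c *s vderiv F x) = tvec (F' x) (c *s vderiv F' x)"
    using assms by blast
next
  fix \<tau> assume "\<exists>U' F'. x \<in> U' \<and> homogeneous_lift f U' F' \<and> \<tau> = tvec (F' x) (c *s vderiv F' x)"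
  then obtain V G where G: "x \<in> V" "homogeneous_lift f V G" and \<tau>: "\<tau> = tvec (G x) (c *s vderiv G x)"
    by blast
  obtain b d where b: "b \<noteq> 0" "G x = b *s F x" "vderiv G x = b *s vderiv F x + d *s F x"
    using homogeneous_lift_change[OF assms(1) G(2) assms(2) G(1)] by blast
  have "c *s vderiv G x = b *s (c *s vderiv F x) + (c * d) *s F x"
    by (simp add: b vec.scale_right_distrib mult.commute)
  then show "\<tau> = tvec (F x) (c *s vderiv F x)"
    unfolding \<tau> b(2) by (simp only: tvec_change[OF b(1)])
qed

text \<open>Carries identities over to an exceptional point, such as a zero of the differential of a
  curve.\<close>

lemma isCont_eq_punctured:
  fixes u v :: "complex \<Rightarrow> 'a::t2_space"
  assumes "isCont u x" "isCont v x" "\<forall>\<^sub>F z in at x. u z = v z"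
  shows "u x = v x"
proof -
  have "(u \<longlongrightarrow> v x) (at x)"
    using assms(2,3) unfolding isCont_def by (simp add: tendsto_cong)
  then show ?thesis
    using assms(1) unfolding isCont_def by (intro tendsto_unique[of "at x"]) auto
qed

section \<open>Normalised lifts and a criterion for constancy\<close>

lemma vholomorphic_isCont:
  assumes "vholomorphic_on F U" "open U" "z \<in> U"
  shows "isCont F z"
  unfolding isCont_def
  by (rule vec_tendstoI)
     (use DERIV_isCont[OF vholomorphic_component_deriv[OF assms]] in \<open>simp add: isCont_def\<close>)

text \<open>An affine chart: a lift is divided by a coordinate that does not vanish at
  \<open>x\<close>. The normalisation leaves no scaling freedom, so constancy of the curve and of
  \<open>F\<close> on the ball become equivalent.\<close>

lemma entire_curve_chart:
  fixes q :: "real^'n \<Rightarrow> real^'n \<Rightarrow> real"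
  assumes "entire_curve q f"
  obtains r i and F :: "complex \<Rightarrow> complex^'n" where "r > 0" "homogeneous_lift f (ball x r) F"
    "\<And>z. z \<in> ball x r \<Longrightarrow> F z $ i = 1"
proof -
  obtain U E where x: "x \<in> U" and E: "homogeneous_lift f U E"
    using assms unfolding entire_curve_def by blast
  then have U: "open U" "vholomorphic_on E U" "E x \<noteq> 0"
    by (auto simp: homogeneous_lift_def)
  obtain i where "E x $ i \<noteq> 0"
    using U(3) by (auto simp: vec_eq_iff)
  moreover have "isCont (\<lambda>z. E z $ i) x"
    using vholomorphic_component_deriv[OF U(2,1) x] by (rule DERIV_isCont)
  ultimately have "\<forall>\<^sub>F z in nhds x. E z $ i \<noteq> 0"
    by (auto simp: isCont_def tendsto_at_iff_tendsto_nhds[of "\<lambda>z. E z $ i"]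
        intro: tendsto_imp_eventually_ne)
  with eventually_nhds_in_open[OF U(1) x] have "\<forall>\<^sub>F z in nhds x. z \<in> U \<and> E z $ i \<noteq> 0"
    by eventually_elim simp
  then obtain r where r: "r > 0" "\<And>z. z \<in> ball x r \<Longrightarrow> z \<in> U \<and> E z $ i \<noteq> 0"
    unfolding eventually_nhds_metric by (auto simp: dist_commute)
  define F where "F z = (1 / E z $ i) *s E z" for z
  have "homogeneous_lift f (ball x r) F"
    unfolding homogeneous_lift_def
  proof (intro conjI ballI)
    show "vholomorphic_on F (ball x r)"
      unfolding vholomorphic_on_def F_def
      using U(2) r(2) by (auto simp: vholomorphic_on_def intro!: holomorphic_intros intro: holomorphic_on_subset)
    fix z assume "z \<in> ball x r"
    from r(2)[OF this] have "E z \<noteq> 0" "f z = cline (E z)" "E z $ i \<noteq> 0"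
      using E by (auto simp: homogeneous_lift_def)
    then show "F z \<noteq> 0" "f z = cline (F z)"
      unfolding F_def by (simp_all add: cline_scale)
  qed simp
  moreover have "F z $ i = 1" if "z \<in> ball x r" for z
    using r(2)[OF that] by (simp add: F_def)
  ultimately show ?thesis
    using r(1) that by blast
qed

lemma vderiv_eq_0_of_constant_component:
  fixes F :: "complex \<Rightarrow> complex^'n"
  assumes "open U" "z \<in> U" "\<And>w. w \<in> U \<Longrightarrow> F w $ i = c"
  shows "vderiv F z $ i = 0"
proof -
  have "\<forall>\<^sub>F w in nhds z. F w $ i = c"
    using eventually_nhds_in_open[OF assms(1,2)] by eventually_elim (rule assms(3))
  from DERIV_cong_ev[OF refl this refl] have "((\<lambda>w. F w $ i) has_field_derivative 0) (at z)"
    by simp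
  then show ?thesis
    unfolding vderiv_def by (simp add: DERIV_imp_deriv)
qed

lemma vderiv_0_imp_constant:
  assumes F: "vholomorphic_on F (ball x r)" and r: "r > 0"
    and 0: "\<And>z. z \<in> ball x r \<Longrightarrow> vderiv F z = 0" and z: "z \<in> ball x r"
  shows "F z = F x"
proof -
  have "F z $ j = F x $ j" for j
  proof -
    have "\<exists>c. \<forall>z\<in>ball x r. F z $ j = c"
    proof (rule has_field_derivative_zero_constant)
      fix w assume w: "w \<in> ball x r"
      show "((\<lambda>z. F z $ j) has_field_derivative 0) (at w within ball x r)"
        using vholomorphic_component_deriv[OF F open_ball w, of j] 0[OF w]
        by (simp add: has_field_derivative_at_within)
    qed simp
    then show ?thesis
      using z r by auto
  qed
  then show ?thesis
    by (simp add: vec_eq_iff)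
qed

text \<open>In a normalised lift the derivative has coordinate 0 where \<open>F\<close> has
  coordinate 1, so a derivative proportional to \<open>F\<close> vanishes. Thus the curve is locally
  constant, and the plane is connected.\<close>

lemma constant_if_all_critical:
  fixes q :: "real^'n \<Rightarrow> real^'n \<Rightarrow> real"
  assumes f: "entire_curve q f"
    and crit: "\<And>x U F. homogeneous_lift f U F \<Longrightarrow> x \<in> U \<Longrightarrow> vderiv F x \<in> cline (F x)"
  shows "f constant_on UNIV"
proof -
  have "f a = f b" for a b
  proof (rule connected_local_const[of UNIV a b f])
    show "\<forall>a\<in>UNIV. \<forall>\<^sub>F b in at a. f a = f b"
    proof
      fix a
      obtain r i and F :: "complex \<Rightarrow> complex^'n" where r: "r > 0" and F: "homogeneous_lift f (ball a r) F"
        and i: "\<And>z. z \<in> ball a r \<Longrightarrow> F z $ i = 1"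
        by (rule entire_curve_chart[OF f, where x = a]) (rule that)
      have F': "vholomorphic_on F (ball a r)"
        using F by (simp add: homogeneous_lift_def)
      have F'0: "vderiv F z = 0" if z: "z \<in> ball a r" for z
      proof -
        obtain c where c: "vderiv F z = c *s F z"
          using crit[OF F z] by (auto simp: mem_cline_iff)
        moreover have "vderiv F z $ i = 0"
          by (rule vderiv_eq_0_of_constant_component[OF open_ball z i])
        ultimately show ?thesis
          using i[OF z] by simp
      qed
      note F_const = vderiv_0_imp_constant[OF F' r F'0]
      have const: "f z = f a" if "z \<in> ball a r" for z
        using F r that F_const[OF _ that] unfolding homogeneous_lift_def by simp
      have "\<forall>\<^sub>F z in nhds a. z \<in> ball a r"
        using r by (intro eventually_nhds_in_open) auto
      then have "\<forall>\<^sub>F z in nhds a. f a = f z"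
        by eventually_elim (simp add: const)
      then show "\<forall>\<^sub>F b in at a. f a = f b"
        unfolding eventually_at_filter by eventually_elim simp
    qed
  qed auto
  then show ?thesis
    unfolding constant_on_def by blast
qed

section \<open>Curves with semi-positive pull-back of the form\<close>

lemma period_domain_cext_hmetric:
  assumes "cline s \<in> period_domain q" "s \<noteq> 0"
  shows "cext q s s = 0" "hmetric q s > 0"
  using assms unfolding period_domain_def by auto

text \<open>The differential sends 1 and \<open>\<i>\<close> to the tangent vectors of F' and
  \<open>\<i>\<close> F', so \<open>GS_cone_J\<close> applies and its negative factor reverses the
  inequality.\<close>

lemma GS_pullback_nonnegD:
  fixes q :: "real^'n \<Rightarrow> real^'n \<Rightarrow> real"
  assumes bil: "bilinear q" and sym: "\<And>x y. q x y = q y x"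
    and f: "entire_curve q f" "GS_pullback_nonneg q f"
    and F: "homogeneous_lift f U F" "x \<in> U"
  shows "hmetric q (vderiv F x) / hmetric q (F x) -
     (cmod (cext q (vderiv F x) (vcnj (F x))))\<^sup>2 / (hmetric q (F x))\<^sup>2 \<le> 0"
proof -
  have "F x \<noteq> 0" "f x = cline (F x)"
    using F by (auto simp: homogeneous_lift_def)
  then have pos: "hmetric q (F x) > 0"
    using f(1) unfolding entire_curve_def by (metis period_domain_cext_hmetric(2))
  have "GS_form q (tvec (F x) (vderiv F x)) (tvec (F x) (\<i> *s vderiv F x)) \<ge> 0"
    using f(2) differential_at_eq[OF F, of 1] differential_at_eq[OF F, of \<i>]
    unfolding GS_pullback_nonneg_def by (metis vec.scale_one)
  then show ?thesis
    unfolding GS_form_tvec[OF bil sym pos] GS_cone_J[OF bil sym pos] by simp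
qed

text \<open>
  The function \<open>\<phi> = ln (\<bar>s\<bar>\<^sup>2 / q (s, cnj s))\<close> is subharmonic along \<open>f\<close>, because its Laplacian is the
  sum of the Fubini--Study and the Griffiths--Schmid energy densities.
\<close>

lemma curve_constant_if_hmetric_bounded_below:
  fixes q :: "real^'n \<Rightarrow> real^'n \<Rightarrow> real"
  assumes bil: "bilinear q" and sym: "\<And>x y. q x y = q y x"
    and f: "entire_curve q f" "GS_pullback_nonneg q f"
    and \<epsilon>: "\<epsilon> > 0"
    and bound: "\<And>x s. s \<in> f x - {0} \<Longrightarrow> hmetric q s > \<epsilon> * hmetric inner s"
  shows "f constant_on UNIV"
proof (rule constant_if_all_critical[OF f(1)])
  \<comment> \<open>An arbitrary choice of representatives, possibly discontinuous, gives a globally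
    defined \<open>\<phi>\<close>. Scale invariance lets it be computed with any local holomorphic
    lift.\<close>
  define sec where "sec z = (SOME s. s \<noteq> 0 \<and> f z = cline s)" for z
  define \<phi> where "\<phi> z = ln (hmetric inner (sec z)) - ln (hmetric q (sec z))" for z
  have hq: "hmetric q s > 0" if "s \<in> f x - {0}" for x s
    using f(1) that unfolding entire_curve_def period_domain_def by auto
  have sec: "sec z \<noteq> 0" "f z = cline (sec z)" for z
  proof -
    have "\<exists>s. s \<noteq> 0 \<and> f z = cline s"
      using f(1) unfolding entire_curve_def period_domain_def proj_space_def by blast
    from someI_ex[OF this] show "sec z \<noteq> 0" "f z = cline (sec z)"
      unfolding sec_def by auto
  qed
  have \<phi>: "\<phi> z = ln (hmetric inner (F z)) - ln (hmetric q (F z))"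
    if F: "homogeneous_lift f U F" and z: "z \<in> U" for U F z
  proof -
    have Fz: "F z \<noteq> 0" "f z = cline (F z)"
      using F z by (auto simp: homogeneous_lift_def)
    then obtain c where c: "c \<noteq> 0" "sec z = c *s F z"
      using sec[of z] cline_eqD[of "sec z" "F z"] by metis
    have "hmetric q (F z) > 0" "hmetric inner (F z) > 0"
      using hq[of "F z" z] Fz by (auto intro: hmetric_inner_pos)
    then show ?thesis
      using c(1) unfolding \<phi>_def c(2) hmetric_scale[OF bil sym]
        hmetric_scale[OF bilinear_inner inner_commute]
      by (simp add: ln_mult)
  qed
  have cont: "continuous_on UNIV \<phi>"
  proof (rule continuous_at_imp_continuous_on, intro ballI)
    fix x :: complex
    obtain U F where F: "homogeneous_lift f U F" "x \<in> U"
      using f(1) unfolding entire_curve_def by blast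
    then have U: "open U" "vholomorphic_on F U" "F x \<noteq> 0" "f x = cline (F x)"
      by (auto simp: homogeneous_lift_def)
    note Fx = vholomorphic_isCont[OF U(2,1) F(2)]
    have "isCont (\<lambda>z. hmetric q (F z)) x"
      by (rule isCont_o2[OF Fx has_derivative_continuous[OF hmetric_has_derivative[OF bil sym]]])
    moreover have "isCont (\<lambda>z. hmetric inner (F z)) x"
      by (rule isCont_o2[OF Fx has_derivative_continuous[OF
            hmetric_has_derivative[OF bilinear_inner inner_commute]]])
    moreover have "hmetric q (F x) \<noteq> 0" "hmetric inner (F x) \<noteq> 0"
      using hq[of "F x" x] hmetric_inner_pos[of "F x"] U by auto
    ultimately have "isCont (\<lambda>z. ln (hmetric inner (F z)) - ln (hmetric q (F z))) x"
      by (intro continuous_intros)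
    moreover have "\<forall>\<^sub>F z in nhds x. \<phi> z = ln (hmetric inner (F z)) - ln (hmetric q (F z))"
      using eventually_nhds_in_open[OF U(1) F(2)] by eventually_elim (rule \<phi>[OF F(1)])
    ultimately show "isCont \<phi> x"
      by (simp add: isCont_cong)
  qed
  have "\<phi> z \<le> - ln \<epsilon>" for z
  proof -
    have *: "hmetric q (sec z) > \<epsilon> * hmetric inner (sec z)" "hmetric inner (sec z) > 0"
      using bound[of "sec z" z] sec[of z] hmetric_inner_pos[of "sec z"] by auto
    then have "ln (\<epsilon> * hmetric inner (sec z)) \<le> ln (hmetric q (sec z))"
      using \<epsilon> by (intro ln_mono) auto
    then show ?thesis
      using * \<epsilon> by (simp add: \<phi>_def ln_mult)
  qed
  note bdd = this
  define A where "A F x = hmetric inner (vderiv F x) / hmetric inner (F x) -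
     (cmod (cext inner (vderiv F x) (vcnj (F x))))\<^sup>2 / (hmetric inner (F x))\<^sup>2"
    for F :: "complex \<Rightarrow> complex^'n" and x
  define B where "B F x = hmetric q (vderiv F x) / hmetric q (F x) -
     (cmod (cext q (vderiv F x) (vcnj (F x))))\<^sup>2 / (hmetric q (F x))\<^sup>2"
    for F :: "complex \<Rightarrow> complex^'n" and x
  have lap: "has_laplacian \<phi> x (4 * A F x - 4 * B F x)" "A F x \<ge> 0" "B F x \<le> 0"
    if F: "homogeneous_lift f U F" "x \<in> U" for F U x
  proof -
    have U: "open U" "vholomorphic_on F U" "F x \<noteq> 0" "f x = cline (F x)"
      using F by (auto simp: homogeneous_lift_def)
    have pos: "hmetric q (F x) > 0" "hmetric inner (F x) > 0"
      using hq[of "F x" x] hmetric_inner_pos[of "F x"] U by auto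
    have "\<forall>\<^sub>F z in nhds x. ln (hmetric inner (F z)) - ln (hmetric q (F z)) = \<phi> z"
      using eventually_nhds_in_open[OF U(1) F(2)] by eventually_elim (rule \<phi>[OF F(1), symmetric])
    moreover have "has_laplacian (\<lambda>z. ln (hmetric inner (F z)) - ln (hmetric q (F z))) x (4 * A F x - 4 * B F x)"
      unfolding A_def B_def
      by (intro has_laplacian_diff
          has_laplacian_ln_hmetric[OF bilinear_inner inner_commute U(2,1) F(2) pos(2)]
          has_laplacian_ln_hmetric[OF bil sym U(2,1) F(2) pos(1)])
    ultimately show "has_laplacian \<phi> x (4 * A F x - 4 * B F x)"
      by (rule has_laplacian_cong[rotated])
    show "A F x \<ge> 0"
      unfolding A_def by (rule hmetric_inner_orthogonal_part_nonneg[OF U(3)])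
    show "B F x \<le> 0"
      unfolding B_def by (rule GS_pullback_nonnegD[OF bil sym f F])
  qed
  have lap': "\<exists>L\<ge>0. has_laplacian \<phi> x L" for x
  proof -
    obtain U F where F: "homogeneous_lift f U F" "x \<in> U"
      using f(1) unfolding entire_curve_def by blast
    from lap[OF F] show ?thesis
      by (intro exI[of _ "4 * A F x - 4 * B F x"]) simp
  qed
  fix x U F assume F: "homogeneous_lift f U F" "x \<in> U"
  have "4 * A F x - 4 * B F x = 0"
    using subharmonic_bounded_laplacian_zero[OF cont lap' bdd lap(1)[OF F]] .
  \<comment> \<open>\<open>A F x\<close> and \<open>- B F x\<close> are both non-negative, so a
    vanishing sum kills each of them.\<close>
  with lap(2,3)[OF F] have "A F x = 0"
    by linarith
  moreover have "F x \<noteq> 0"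
    using F by (auto simp: homogeneous_lift_def)
  ultimately show "vderiv F x \<in> cline (F x)"
    unfolding A_def using hmetric_inner_orthogonal_part_eq_0 by blast
qed

section \<open>The lift of a curve to the bundle of tangent lines\<close>

text \<open>The identity theorem for curves: by analytic continuation of a normalised lift, a chart
  ball meeting \<open>S\<close> lies inside \<open>S\<close>. So membership in \<open>S\<close> is
  locally constant on the connected plane.\<close>

lemma locally_constant_imp_constant_curve:
  fixes q :: "real^'n \<Rightarrow> real^'n \<Rightarrow> real"
  assumes f: "entire_curve q f" and x: "\<forall>\<^sub>F y in nhds x. f y = f x"
  shows "f constant_on UNIV"
proof -
  define S where "S = {x. \<forall>\<^sub>F y in nhds x. f y = f x}"
  have ball_S: "ball a r \<subseteq> S" if F: "homogeneous_lift f (ball a r) F" "\<And>z. z \<in> ball a r \<Longrightarrow> F z $ i = 1"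
    and b: "b \<in> S" "b \<in> ball a r" for a b r i and F :: "complex \<Rightarrow> complex^'n"
  proof -
    have F': "vholomorphic_on F (ball a r)" "\<And>z. z \<in> ball a r \<Longrightarrow> F z \<noteq> 0 \<and> f z = cline (F z)"
      using F(1) by (auto simp: homogeneous_lift_def)
    have F_eq: "F y = F z" if "f y = f z" "y \<in> ball a r" "z \<in> ball a r" for y z
    proof -
      have "cline (F y) = cline (F z)" "F y \<noteq> 0"
        using that F'(2) by auto
      then obtain c where c: "F y = c *s F z"
        by (rule cline_eqD)
      from arg_cong[OF c, of "\<lambda>v. v $ i"] have "c = 1"
        using F(2)[OF that(2)] F(2)[OF that(3)] by simp
      then show ?thesis
        by (simp add: c)
    qed
    have "\<forall>\<^sub>F y in nhds b. f y = f b"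
      using b(1) by (simp add: S_def)
    moreover have "\<forall>\<^sub>F y in nhds b. y \<in> ball a r"
      using b(2) by (intro eventually_nhds_in_open) auto
    ultimately have "\<forall>\<^sub>F y in nhds b. y \<in> ball a r \<and> F y = F b"
    proof eventually_elim
      case (elim y)
      then show ?case
        using F_eq[OF elim(1,2) b(2)] by simp
    qed
    then obtain V where V: "open V" "b \<in> V" "\<And>y. y \<in> V \<Longrightarrow> y \<in> ball a r \<and> F y = F b"
      unfolding eventually_nhds by blast
    have const: "F y $ j = F b $ j" if "y \<in> ball a r" for y j
    proof (rule analytic_continuation_open[of V "ball a r" "\<lambda>y. F y $ j" "\<lambda>y. F b $ j"])
      show "(\<lambda>y. F y $ j) holomorphic_on ball a r"
        using F'(1) by (simp add: vholomorphic_on_def)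
      show "F z $ j = F b $ j" if "z \<in> V" for z
        using V(3)[OF that] by simp
    qed (use V(1,2) that in \<open>auto dest: V(3)\<close>)
    have "f y = f b" if "y \<in> ball a r" for y
    proof -
      have "F y = F b"
        using const[OF that] by (simp add: vec_eq_iff)
      then show ?thesis
        using F'(2)[OF that] F'(2)[OF b(2)] by simp
    qed
    note fb = this
    show "ball a r \<subseteq> S"
    proof
      fix z assume z: "z \<in> ball a r"
      then have "\<forall>\<^sub>F y in nhds z. y \<in> ball a r"
        by (intro eventually_nhds_in_open) auto
      then have "\<forall>\<^sub>F y in nhds z. f y = f z"
        by eventually_elim (rule trans[OF fb fb[OF z, symmetric]])
      then show "z \<in> S"
        by (simp add: S_def)
    qed
  qed
  have S_iff: "(a \<in> S) = (x \<in> S)" for a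
  proof (rule connected_local_const[of UNIV a x "\<lambda>a. a \<in> S"])
    show "\<forall>a\<in>UNIV. \<forall>\<^sub>F b in at a. (a \<in> S) = (b \<in> S)"
    proof
      fix a
      obtain r i and F :: "complex \<Rightarrow> complex^'n"
        where r: "r > 0" and F: "homogeneous_lift f (ball a r) F"
        and i: "\<And>z. z \<in> ball a r \<Longrightarrow> F z $ i = 1"
        by (rule entire_curve_chart[OF f, where x = a]) (rule that)
      have "\<forall>\<^sub>F b in nhds a. b \<in> ball a r"
        using r by (intro eventually_nhds_in_open) auto
      then have "\<forall>\<^sub>F b in nhds a. (a \<in> S) = (b \<in> S)"
      proof eventually_elim
        case (elim b)
        have "a \<in> ball a r"
          using r by simp
        then show ?case
          using ball_S[OF F i, of a] ball_S[OF F i, of b] elim by blast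
      qed
      then show "\<forall>\<^sub>F b in at a. (a \<in> S) = (b \<in> S)"
        unfolding eventually_at_filter by eventually_elim simp
    qed
  qed auto
  have "x \<in> S"
    using x by (simp add: S_def)
  then have S: "a \<in> S" for a
    unfolding S_iff[of a] .
  have "f a = f b" for a b
  proof (rule connected_local_const[of UNIV a b f])
    show "\<forall>a\<in>UNIV. \<forall>\<^sub>F b in at a. f a = f b"
    proof
      fix a
      have "\<forall>\<^sub>F b in nhds a. f b = f a"
        using S[of a] by (simp add: S_def)
      then show "\<forall>\<^sub>F b in at a. f a = f b"
        unfolding eventually_at_filter by eventually_elim simp
    qed
  qed auto
  then show ?thesis
    unfolding constant_on_def by blast
qed

text \<open>If every quotient of \<open>E\<close> by a power of z - x vanished at \<open>x\<close>,
  one could divide forever, contradicting the finite zero order of a component that is not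
  identically zero.\<close>

lemma vholomorphic_factor_zero:
  fixes E :: "complex \<Rightarrow> complex^'n"
  assumes E: "vholomorphic_on E (ball x r)" and r: "r > 0"
    and nz: "z0 \<in> ball x r" "E z0 \<noteq> 0"
  obtains k G where "vholomorphic_on G (ball x r)" "G x \<noteq> 0"
    "\<And>z. z \<in> ball x r \<Longrightarrow> E z = (z - x) ^ k *s G z"
proof (rule ccontr)
  assume contra: "\<not> thesis"
  note factor = that
  define P where "P k G \<longleftrightarrow> vholomorphic_on G (ball x r) \<and> (\<forall>z\<in>ball x r. E z = (z - x) ^ k *s G z)"
    for k and G :: "complex \<Rightarrow> complex^'n"
  have Gx: "G x = 0" if "P k G" for k G
    using that contra factor unfolding P_def by blast
  have all: "\<exists>G. P k G" for k
  proof (induction k)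
    case 0
    then show ?case
      using E by (intro exI[of _ E]) (simp add: P_def)
  next
    case (Suc k)
    then obtain G where G: "P k G" by blast
    \<comment> \<open>The difference quotient, with its removable singularity filled by the
      derivative.\<close>
    define H where "H z = (\<chi> j. if z = x then deriv (\<lambda>z. G z $ j) x else (G z $ j - G x $ j) / (z - x))" for z
    have "vholomorphic_on H (ball x r)"
      unfolding vholomorphic_on_def
    proof
      fix j
      have "(\<lambda>z. G z $ j) holomorphic_on ball x r"
        using G by (simp add: P_def vholomorphic_on_def)
      from pole_lemma_open[OF this open_ball, of x]
      show "(\<lambda>z. H z $ j) holomorphic_on ball x r"
        by (simp add: H_def)
    qed
    moreover have "G z = (z - x) *s H z" for z
    proof (cases "z = x")
      case True
      then show ?thesis
        using Gx[OF G] by (simp add: vec_eq_iff)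
    next
      case False
      then have "H z = (1 / (z - x)) *s G z"
        using Gx[OF G] by (simp add: H_def vec_eq_iff)
      then show ?thesis
        using False by simp
    qed
    then have "E z = (z - x) ^ Suc k *s H z" if "z \<in> ball x r" for z
      using G that unfolding P_def by (metis power_Suc2 vec.scale_scale)
    ultimately show ?case
      unfolding P_def by blast
  qed
  obtain j where j: "E z0 $ j \<noteq> 0"
    using nz(2) by (auto simp: vec_eq_iff)
  have Ex: "E x = 0"
  proof -
    obtain G where "P 1 G" using all by blast
    then show ?thesis
      using r by (simp add: P_def)
  qed
  have nc: "\<not> (\<lambda>z. E z $ j) constant_on ball x r"
  proof
    assume "(\<lambda>z. E z $ j) constant_on ball x r"
    then have "E z0 $ j = E x $ j"
      using nz(1) r unfolding constant_on_def by (metis centre_in_ball)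
    with j Ex show False by simp
  qed
  have holE: "(\<lambda>z. E z $ j) holomorphic_on ball x r"
    using E by (simp add: vholomorphic_on_def)
  have xr: "x \<in> ball x r" "E x $ j = 0"
    using r Ex by simp_all
  obtain g s n where g: "0 < s" "ball x s \<subseteq> ball x r" "g holomorphic_on ball x s"
      "\<And>w. w \<in> ball x s \<Longrightarrow> E w $ j = (w - x) ^ n * g w" "\<And>w. w \<in> ball x s \<Longrightarrow> g w \<noteq> 0"
    using holomorphic_factor_zero_nonconstant[OF holE open_ball connected_ball xr nc] by metis
  \<comment> \<open>One power more than the zero order \<open>n\<close> of the component
    \<open>j\<close>; cancelling forces \<open>g x = 0\<close>.\<close>
  obtain G where G: "P (Suc n) G"
    using all by blast
  have holG: "(\<lambda>z. G z $ j) holomorphic_on ball x s"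
    using G g(2) by (auto simp: P_def vholomorphic_on_def intro: holomorphic_on_subset)
  have isC: "isCont u x" if "u holomorphic_on ball x s" for u
    using that g(1) holomorphic_on_imp_continuous_on
    by (metis centre_in_ball continuous_on_interior interior_ball)
  have "g x = (x - x) * G x $ j"
  proof (rule isCont_eq_punctured[where u = g and v = "\<lambda>w. (w - x) * G w $ j"])
    show "isCont g x"
      by (rule isC[OF g(3)])
    show "isCont (\<lambda>w. (w - x) * G w $ j) x"
      by (intro isC holomorphic_intros holG)
    have "\<forall>\<^sub>F w in at x. w \<in> ball x s \<and> w \<noteq> x"
      using eventually_at_ball'[OF g(1), of x UNIV] by eventually_elim simp
    then show "\<forall>\<^sub>F w in at x. g w = (w - x) * G w $ j"
    proof eventually_elim
      case (elim w)
      then have "(w - x) ^ n * g w = (w - x) ^ Suc n * G w $ j"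
        using g(2,4) G unfolding P_def by (metis subsetD vector_smult_component)
      with elim show ?case
        by simp
    qed
  qed
  then show False
    using g(5)[of x] g(1) by simp
qed

text \<open>Local data for the extended lift: \<open>G\<close> represents the tangent direction even
  if the differential vanishes at the centre \<open>x\<close>, the only point of the ball where this
  may happen.\<close>

definition tangent_lift ::
  "(real^'n \<Rightarrow> real^'n \<Rightarrow> real) \<Rightarrow> (complex \<Rightarrow> (complex^'n) set) \<Rightarrow> complex \<Rightarrow> real \<Rightarrow>
    (complex \<Rightarrow> complex^'n) \<Rightarrow> (complex \<Rightarrow> complex^'n) \<Rightarrow> bool" where
  "tangent_lift q f x r F G \<longleftrightarrow> r > 0 \<and> homogeneous_lift f (ball x r) F \<and> vholomorphic_on G (ball x r) \<and>
     (\<forall>z\<in>ball x r. (F z, G z) \<in> tangent_pairs q) \<and>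
     (\<forall>z\<in>ball x r. \<exists>a. vderiv F z = a *s G z \<and> (z \<noteq> x \<longrightarrow> a \<noteq> 0))"

text \<open>Tangency to the quadric, obtained by differentiating q (F, F) = 0 along a real direction
  and using symmetry.\<close>

lemma cext_vderiv_eq_0:
  fixes q :: "real^'n \<Rightarrow> real^'n \<Rightarrow> real"
  assumes bil: "bilinear q" and sym: "\<And>x y. q x y = q y x"
    and F: "vholomorphic_on F U" "open U" "\<And>z. z \<in> U \<Longrightarrow> cext q (F z) (F z) = 0" and z: "z \<in> U"
  shows "cext q (F z) (vderiv F z) = 0"
proof -
  have z0: "z + of_real 0 * 1 \<in> U"
    using z by simp
  note D = vholomorphic_line_derivative[OF F(1,2) z0]
  have "((\<lambda>t. cext q (F (z + of_real t * 1)) (F (z + of_real t * 1))) has_vector_derivative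
      cext q (F z) (vderiv F z) + cext q (vderiv F z) (F z)) (at 0)"
    using bounded_bilinear.has_vector_derivative[OF bounded_bilinear_cext[OF bil sym] D D] by simp
  moreover have "((\<lambda>t. cext q (F (z + of_real t * 1)) (F (z + of_real t * 1))) has_vector_derivative 0) (at 0)"
  proof -
    have "filterlim (\<lambda>t. z + of_real t * 1) (nhds z) (nhds (0::real))"
      by (rule tendsto_eq_intros refl filterlim_ident | simp)+
    with eventually_nhds_in_open[OF F(2) z] have "\<forall>\<^sub>F t in nhds (0::real). z + of_real t * 1 \<in> U"
      by (rule eventually_compose_filterlim)
    then have "\<forall>\<^sub>F t in nhds (0::real). cext q (F (z + of_real t * 1)) (F (z + of_real t * 1)) = 0"
      by eventually_elim (rule F(3))
    then obtain V where V: "open V" "0 \<in> V"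
      "\<And>t. t \<in> V \<Longrightarrow> cext q (F (z + of_real t * 1)) (F (z + of_real t * 1)) = 0"
      unfolding eventually_nhds by blast
    show ?thesis
      by (rule has_vector_derivative_transform_within_open[OF has_vector_derivative_const V(1,2)])
         (simp only: V(3))
  qed
  ultimately have "cext q (F z) (vderiv F z) + cext q (vderiv F z) (F z) = 0"
    by (rule vector_derivative_unique_at)
  moreover have "cext q (vderiv F z) (F z) = cext q (F z) (vderiv F z)"
    by (simp add: cext_def sym[of "vRe (vderiv F z)"] sym[of "vIm (vderiv F z)"])
  ultimately show ?thesis
    by simp
qed

text \<open>\<open>G\<close> is the derivative of a normalised lift divided by the exact power of z
  - x. Such a power exists because a derivative vanishing on the whole ball would make the curve
  constant.\<close>

lemma tangent_lift_exists:
  fixes q :: "real^'n \<Rightarrow> real^'n \<Rightarrow> real"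
  assumes bil: "bilinear q" and sym: "\<And>x y. q x y = q y x"
    and f: "entire_curve q f" "\<not> f constant_on UNIV"
  shows "\<exists>r F G. tangent_lift q f x r F G"
proof -
  obtain r i and F :: "complex \<Rightarrow> complex^'n"
    where r: "r > 0" and F: "homogeneous_lift f (ball x r) F"
      and i: "\<And>z. z \<in> ball x r \<Longrightarrow> F z $ i = 1"
    by (rule entire_curve_chart[OF f(1), where x = x]) (rule that)
  have F': "vholomorphic_on F (ball x r)" "\<And>z. z \<in> ball x r \<Longrightarrow> F z \<noteq> 0 \<and> f z = cline (F z)"
    using F by (auto simp: homogeneous_lift_def)
  have pd: "cline (F z) \<in> period_domain q" if "z \<in> ball x r" for z
    using F'(2)[OF that] f(1) unfolding entire_curve_def by metis
  have "\<exists>z\<in>ball x r. vderiv F z \<noteq> 0"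
  proof (rule ccontr)
    assume "\<not> (\<exists>z\<in>ball x r. vderiv F z \<noteq> 0)"
    then have "F z = F x" if "z \<in> ball x r" for z
      using vderiv_0_imp_constant[OF F'(1) r _ that] by blast
    then have fx: "f z = f x" if "z \<in> ball x r" for z
      using F'(2) that r by (metis centre_in_ball)
    have "\<forall>\<^sub>F z in nhds x. z \<in> ball x r"
      using r by (intro eventually_nhds_in_open) auto
    then have "\<forall>\<^sub>F z in nhds x. f z = f x"
      by eventually_elim (rule fx)
    with locally_constant_imp_constant_curve[OF f(1)] f(2) show False
      by blast
  qed
  then obtain z0 where z0: "z0 \<in> ball x r" "vderiv F z0 \<noteq> 0"
    by blast
  obtain k G where G: "vholomorphic_on G (ball x r)" "G x \<noteq> 0"
    "\<And>z. z \<in> ball x r \<Longrightarrow> vderiv F z = (z - x) ^ k *s G z"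
    using vholomorphic_factor_zero[OF vholomorphic_on_vderiv[OF F'(1) open_ball] r z0] by blast
  have xr: "x \<in> ball x r"
    using r by simp
  have F_cont: "isCont F x" and G_cont: "isCont G x"
    using vholomorphic_isCont[OF F'(1) open_ball xr] vholomorphic_isCont[OF G(1) open_ball xr] by auto
  have punct: "\<forall>\<^sub>F z in at x. z \<in> ball x r \<and> z \<noteq> x"
    using eventually_at_ball'[OF r, of x UNIV] by eventually_elim simp
  \<comment> \<open>Since \<open>F\<close> has coordinate 1 at \<open>i\<close>, this ensures that a
    non-zero \<open>G z\<close> cannot lie on the line of \<open>F z\<close>.\<close>
  have Gi: "G z $ i = 0" if z: "z \<in> ball x r" for z
  proof -
    have *: "G z $ i = 0" if z: "z \<in> ball x r" "z \<noteq> x" for z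
      using G(3)[OF z(1)] vderiv_eq_0_of_constant_component[OF open_ball z(1), of F i 1] i z(2)
      by simp
    have "G x $ i = 0"
    proof (rule isCont_eq_punctured[where u = "\<lambda>z. G z $ i" and v = "\<lambda>_. 0"])
      show "isCont (\<lambda>z. G z $ i) x"
        using G_cont by (intro continuous_intros)
      show "\<forall>\<^sub>F z in at x. G z $ i = 0"
        using punct by eventually_elim (simp add: *)
    qed auto
    with * z show ?thesis
      by (cases "z = x") auto
  qed
  have qG: "cext q (F z) (G z) = 0" if z: "z \<in> ball x r" for z
  proof -
    have *: "cext q (F z) (G z) = 0" if z: "z \<in> ball x r" "z \<noteq> x" for z
    proof -
      have "cext q (F z) (F z) = 0" if "z \<in> ball x r" for z
        using period_domain_cext_hmetric(1)[OF pd[OF that]] F'(2)[OF that] by blast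
      from cext_vderiv_eq_0[OF bil sym F'(1) open_ball this z(1)]
      have "(z - x) ^ k * cext q (F z) (G z) = 0"
        unfolding G(3)[OF z(1)] cext_simps[OF bil sym] .
      with z(2) show ?thesis by simp
    qed
    have "cext q (F x) (G x) = 0"
    proof (rule isCont_eq_punctured[where u = "\<lambda>z. cext q (F z) (G z)" and v = "\<lambda>_. 0"])
      show "isCont (\<lambda>z. cext q (F z) (G z)) x"
        using F_cont G_cont by (rule bounded_bilinear.isCont[OF bounded_bilinear_cext[OF bil sym]])
      show "\<forall>\<^sub>F z in at x. cext q (F z) (G z) = 0"
        using punct by eventually_elim (simp add: *)
    qed auto
    with * z show ?thesis
      by (cases "z = x") auto
  qed
  have "\<forall>\<^sub>F z in nhds x. G z \<noteq> 0"
    using G_cont G(2) unfolding isCont_def tendsto_at_iff_tendsto_nhds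
    by (auto intro: tendsto_imp_eventually_ne)
  moreover have "\<forall>\<^sub>F z in nhds x. z \<in> ball x r"
    using r by (intro eventually_nhds_in_open) auto
  ultimately have "\<forall>\<^sub>F z in nhds x. z \<in> ball x r \<and> G z \<noteq> 0"
    by eventually_elim simp
  then obtain \<rho> where \<rho>: "\<rho> > 0" "\<And>z. z \<in> ball x \<rho> \<Longrightarrow> z \<in> ball x r \<and> G z \<noteq> 0"
    unfolding eventually_nhds_metric by (auto simp: dist_commute)
  have sub: "ball x \<rho> \<subseteq> ball x r"
    using \<rho>(2) by blast
  have "G z \<notin> cline (F z)" if z: "z \<in> ball x \<rho>" for z
  proof
    assume "G z \<in> cline (F z)"
    then obtain c where c: "G z = c *s F z"
      by (auto simp: mem_cline_iff)
    moreover have "c = 0"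
      using arg_cong[OF c, of "\<lambda>v. v $ i"] Gi[of z] i[of z] \<rho>(2)[OF z] by simp
    ultimately show False
      using \<rho>(2)[OF z] by simp
  qed
  then have "tangent_lift q f x \<rho> F G"
    unfolding tangent_lift_def tangent_pairs_def homogeneous_lift_def
    using \<rho> F'(2) pd qG G(3) vholomorphic_on_subset[OF F'(1) sub] vholomorphic_on_subset[OF G(1) sub]
    by (auto intro!: exI[of _ "(_ - x) ^ k"])
  then show ?thesis by blast
qed

text \<open>Equality of lines is turned into vanishing of two-by-two minors, a condition on
  continuous functions that passes to the limit at \<open>x\<close>.\<close>

lemma tline_limit_unique:
  fixes F G F' G' :: "complex \<Rightarrow> complex^'n"
  assumes cont: "isCont F x" "isCont G x" "isCont F' x" "isCont G' x"
    and nz: "F x \<noteq> 0" "F' x \<noteq> 0" "G x \<notin> cline (F x)" "G' x \<notin> cline (F' x)"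
    and eq: "\<forall>\<^sub>F z in at x. F' z \<noteq> 0 \<and> tline (F' z) (G' z) = tline (F z) (G z)"
  shows "tline (F' x) (G' x) = tline (F x) (G x)"
proof -
  obtain i where i: "F x $ i \<noteq> 0"
    using nz(1) by (auto simp: vec_eq_iff)
  \<comment> \<open>Removes multiples of \<open>F\<close>: the coordinate \<open>i\<close> of
    \<open>E\<close> is zero, and proportionality of \<open>E\<close> and \<open>E'\<close>
    expresses equality of the directions modulo the base line.\<close>
  define E where "E z = F z $ i *s G z - G z $ i *s F z" for z
  define E' where "E' z = F z $ i *s G' z - G' z $ i *s F z" for z
  have F: "F' x $ i * F x $ j = F x $ i * F' x $ j" for j
  proof (rule isCont_eq_punctured[where u = "\<lambda>z. F' z $ i * F z $ j"])
    show "\<forall>\<^sub>F z in at x. F' z $ i * F z $ j = F z $ i * F' z $ j"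
      using eq
    proof eventually_elim
      case (elim z)
      then obtain c where "F' z = c *s F z"
        using tline_eqD by metis
      then show ?case by simp
    qed
  qed (intro continuous_intros cont)+
  have E: "E' x $ j * E x $ k = E' x $ k * E x $ j" for j k
  proof (rule isCont_eq_punctured[where u = "\<lambda>z. E' z $ j * E z $ k"])
    show "\<forall>\<^sub>F z in at x. E' z $ j * E z $ k = E' z $ k * E z $ j"
      using eq
    proof eventually_elim
      case (elim z)
      then obtain c a d where "G' z = a *s G z + d *s F z"
        using tline_eqD by metis
      then have "E' z = a *s E z"
        by (simp add: E_def E'_def vec_eq_iff algebra_simps)
      then show ?case by simp
    qed
  qed (unfold E_def E'_def vector_minus_component vector_smult_component, (intro continuous_intros cont)+)
  define c where "c = F' x $ i / F x $ i"
  have c: "F' x = c *s F x"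
    using F i by (simp add: c_def vec_eq_iff field_simps)
  with nz(2) have c0: "c \<noteq> 0"
    by auto
  have "E x \<noteq> 0"
  proof
    assume "E x = 0"
    then have "G x = (G x $ i / F x $ i) *s F x"
      using i by (simp add: E_def vec_eq_iff field_simps)
    with nz(3) show False
      by (auto simp: mem_cline_iff)
  qed
  then obtain k where k: "E x $ k \<noteq> 0"
    by (auto simp: vec_eq_iff)
  define a where "a = E' x $ k / E x $ k"
  define d where "d = (G' x $ i - a * G x $ i) / F x $ i"
  have "E' x = a *s E x"
    using E[of _ k] k by (simp add: a_def vec_eq_iff field_simps)
  then have "F x $ i *s G' x = (F x $ i * a) *s G x + (G' x $ i - a * G x $ i) *s F x"
    by (simp add: E_def E'_def vec_eq_iff algebra_simps)
  then have G': "G' x = a *s G x + d *s F x"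
    using i by (simp add: d_def vec_eq_iff field_simps)
  \<comment> \<open>Otherwise \<open>G' x\<close> would lie on the base line, contrary to its being
    a tangent direction.\<close>
  have "a \<noteq> 0"
  proof
    assume "a = 0"
    then have "G' x = (d / c) *s F' x"
      using c0 by (simp add: G' c)
    with nz(4) show False
      by (auto simp: mem_cline_iff)
  qed
  then show ?thesis
    unfolding c G' by (rule tline_change[OF c0])
qed

text \<open>Resolves the definite description: local tangent lifts glue to one map \<open>g\<close>,
  and any competitor agrees with it off the zeros of the differential, hence everywhere by
  \<open>tline_limit_unique\<close>.\<close>

lemma curve_lift_eq:
  fixes q :: "real^'n \<Rightarrow> real^'n \<Rightarrow> real"
  assumes bil: "bilinear q" and sym: "\<And>x y. q x y = q y x"
    and f: "entire_curve q f" "\<not> f constant_on UNIV"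
  obtains s v where "(s, v) \<in> tangent_pairs q" "f x = cline s" "curve_lift q f x = tline s v"
proof -
  obtain r F G where lift: "\<And>x. tangent_lift q f x (r x) (F x) (G x)"
    using tangent_lift_exists[OF bil sym f] by metis
  have r: "r x > 0" and F: "homogeneous_lift f (ball x (r x)) (F x)"
    and Fh: "vholomorphic_on (F x) (ball x (r x))" and Gh: "vholomorphic_on (G x) (ball x (r x))" for x
    using lift[of x] by (auto simp: tangent_lift_def homogeneous_lift_def)
  have tp: "(F x z, G x z) \<in> tangent_pairs q" and
    ex: "\<exists>a. vderiv (F x) z = a *s G x z \<and> (z \<noteq> x \<longrightarrow> a \<noteq> 0)" if "z \<in> ball x (r x)" for x z
    using lift[of x] that by (auto simp: tangent_lift_def)
  \<comment> \<open>At every point the value comes from the tangent lift centred there.\<close>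
  define g where "g x = tline (F x x) (G x x)" for x
  have self: "x \<in> ball x (r x)" for x
    using r by simp
  have tline_scale: "tline s (a *s v) = tline s v" if "a \<noteq> 0" for a and s v :: "complex^'n"
    using tline_change[of 1 a s v 0] that by simp
  have not_line: "vderiv (F x) z \<notin> cline (F x z)" if z: "z \<in> ball x (r x)" "z \<noteq> x" for x z
  proof
    assume "vderiv (F x) z \<in> cline (F x z)"
    moreover obtain a where a: "vderiv (F x) z = a *s G x z" "a \<noteq> 0"
      using ex[OF z(1)] z(2) by blast
    ultimately obtain b where "a *s G x z = b *s F x z"
      by (auto simp: mem_cline_iff)
    then have "G x z = (b / a) *s F x z"
      using a(2) by (simp add: vec_eq_iff field_simps)
    then show False
      using tp[OF z(1)] by (auto simp: tangent_pairs_def mem_cline_iff)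
  qed
  have crit: "g x = tline s v"
    if s: "s \<noteq> 0" "differential_at f x 1 = tvec s v" "v \<notin> cline s" for x s v
  proof -
    have "tvec s v = tvec (F x x) (vderiv (F x) x)"
      using s(2) differential_at_eq[OF F self, of x 1] by simp
    then obtain c d where c: "c \<noteq> 0" "s = c *s F x x" "v = c *s vderiv (F x) x + d *s F x x"
      using s(1) by (rule tvec_eqD)
    obtain a where a: "vderiv (F x) x = a *s G x x"
      using ex[OF self] by blast
    have "a \<noteq> 0"
    proof
      assume "a = 0"
      then have "v = (d / c) *s s"
        using c a by simp
      with s(3) show False
        by (auto simp: mem_cline_iff)
    qed
    then have "tline s v = tline (F x x) (G x x)"
      unfolding c(2,3) a using tline_change[OF c(1), of "c * a" "F x x" "G x x" d] c(1) by simp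
    then show ?thesis
      by (simp add: g_def)
  qed
  \<comment> \<open>Off the centre \<open>x\<close> the differential is non-zero, so
    \<open>crit\<close> at \<open>z\<close> identifies the value from the lift centred at
    \<open>z\<close> with that from the lift centred at \<open>x\<close>.\<close>
  have g_local: "g z = tline (F x z) (G x z)" if z: "z \<in> ball x (r x)" for x z
  proof (cases "z = x")
    case False
    obtain a where a: "vderiv (F x) z = a *s G x z" "a \<noteq> 0"
      using ex[OF z] False by blast
    have "g z = tline (F x z) (vderiv (F x) z)"
    proof (rule crit)
      show "F x z \<noteq> 0"
        using F[of x] z by (simp add: homogeneous_lift_def)
      show "differential_at f z 1 = tvec (F x z) (vderiv (F x) z)"
        using differential_at_eq[OF F z, of 1] by simp
    qed (rule not_line[OF z False])
    then show ?thesis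
      by (simp add: a tline_scale)
  qed (simp add: g_def)
  have "curve_lift q f = g"
    unfolding curve_lift_def
  proof (rule the_equality)
    have "PT_curve q g"
      unfolding PT_curve_def
    proof
      fix x
      show "\<exists>U F G. open U \<and> x \<in> U \<and> vholomorphic_on F U \<and> vholomorphic_on G U \<and>
        (\<forall>z\<in>U. (F z, G z) \<in> tangent_pairs q \<and> g z = tline (F z) (G z))"
        by (intro exI[of _ "ball x (r x)"] exI[of _ "F x"] exI[of _ "G x"] conjI open_ball self Fh Gh ballI
            tp g_local)
    qed
    with crit show "PT_curve q g \<and>
        (\<forall>x s v. s \<noteq> 0 \<and> differential_at f x 1 = tvec s v \<and> v \<notin> cline s \<longrightarrow> g x = tline s v)"
      by blast
  next
    fix h assume h: "PT_curve q h \<and>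
        (\<forall>x s v. s \<noteq> 0 \<and> differential_at f x 1 = tvec s v \<and> v \<notin> cline s \<longrightarrow> h x = tline s v)"
    show "h = g"
    proof
      fix x
      obtain U F' G' where U: "open U" "x \<in> U" "vholomorphic_on F' U" "vholomorphic_on G' U"
        and h': "\<And>z. z \<in> U \<Longrightarrow> (F' z, G' z) \<in> tangent_pairs q \<and> h z = tline (F' z) (G' z)"
        using h unfolding PT_curve_def by meson
      have "tline (F' x) (G' x) = tline (F x x) (G x x)"
      proof (rule tline_limit_unique[where F = "F x" and G = "G x" and F' = F' and G' = G'])
        show "isCont (F x) x" "isCont (G x) x" "isCont F' x" "isCont G' x"
          using vholomorphic_isCont[OF Fh open_ball self] vholomorphic_isCont[OF Gh open_ball self]
            vholomorphic_isCont[OF U(3,1,2)] vholomorphic_isCont[OF U(4,1,2)] by auto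
        show "F x x \<noteq> 0" "F' x \<noteq> 0" "G x x \<notin> cline (F x x)" "G' x \<notin> cline (F' x)"
          using tp[OF self] h'[OF U(2)] by (auto simp: tangent_pairs_def)
        have "\<forall>\<^sub>F z in at x. z \<in> U \<inter> ball x (r x) \<and> z \<noteq> x"
        proof -
          have "\<forall>\<^sub>F z in nhds x. z \<in> U \<inter> ball x (r x)"
            using U self by (intro eventually_nhds_in_open) auto
          then show ?thesis
            unfolding eventually_at_filter by eventually_elim simp
        qed
        then show "\<forall>\<^sub>F z in at x. F' z \<noteq> 0 \<and> tline (F' z) (G' z) = tline (F x z) (G x z)"
        proof eventually_elim
          case (elim z)
          then have z: "z \<in> ball x (r x)" "z \<in> U" "z \<noteq> x" by auto
          obtain a where a: "vderiv (F x) z = a *s G x z" "a \<noteq> 0"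
            using ex[OF z(1)] z(3) by blast
          have "F x z \<noteq> 0"
            using F[of x] z by (simp add: homogeneous_lift_def)
          moreover have "differential_at f z 1 = tvec (F x z) (vderiv (F x) z)"
            using differential_at_eq[OF F z(1), of 1] by simp
          ultimately have "h z = tline (F x z) (vderiv (F x) z)"
            using h not_line[OF z(1,3)] by blast
          then have "tline (F' z) (G' z) = tline (F x z) (G x z)"
            using h'[OF z(2)] by (simp add: a tline_scale)
          moreover have "F' z \<noteq> 0"
            using h'[OF z(2)] by (simp add: tangent_pairs_def)
          ultimately show ?case by blast
        qed
      qed
      then show "h x = g x"
        using h'[OF U(2)] by (simp add: g_def)
    qed
  qed
  then have "curve_lift q f x = tline (F x x) (G x x)"
    by (simp add: g_def)
  moreover have "f x = cline (F x x)"
    using F[of x] self by (simp add: homogeneous_lift_def)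
  ultimately show ?thesis
    using that tp[OF self] by blast
qed

section \<open>The two exhaustions\<close>

definition exhaustion :: "(real^'n \<Rightarrow> real^'n \<Rightarrow> real) \<Rightarrow> real \<Rightarrow> (complex^'n) set set" where
  "exhaustion q \<eta> = {\<sigma> \<in> period_domain q. \<forall>s\<in>\<sigma> - {0}. hmetric q s > \<eta> * hmetric inner s}"

text \<open>The base point of a tangent line is reached through representatives. By
  \<open>tline_eq_imp_cline_eq\<close> all of them give the same point, so the quantifier imposes
  one condition.\<close>

definition PT_exhaustion :: "(real^'n \<Rightarrow> real^'n \<Rightarrow> real) \<Rightarrow> real \<Rightarrow> 'n tangent set set" where
  "PT_exhaustion q \<eta> = {l \<in> PT_plus q. \<forall>s v. (s, v) \<in> tangent_pairs q \<and> l = tline s v \<longrightarrow> cline s \<in> exhaustion q \<eta>}"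

lemma continuous_on_hmetric:
  assumes "bilinear q" "\<And>x y. q x y = q y x"
  shows "continuous_on S (hmetric q)"
  by (intro continuous_at_imp_continuous_on ballI has_derivative_continuous[OF hmetric_has_derivative[OF assms]])

context
  fixes q :: "real^'n \<Rightarrow> real^'n \<Rightarrow> real"
  assumes bil: "bilinear q" and sym: "\<And>x y. q x y = q y x"
begin

text \<open>Both sides scale by the same factor |c|^2, so one representative decides for the whole
  line.\<close>

lemma hmetric_bound_cline:
  assumes "s \<noteq> 0"
  shows "(\<forall>t\<in>cline s - {0}. hmetric q t > \<eta> * hmetric inner t) \<longleftrightarrow> hmetric q s > \<eta> * hmetric inner s"
proof
  assume "\<forall>t\<in>cline s - {0}. hmetric q t > \<eta> * hmetric inner t"
  then show "hmetric q s > \<eta> * hmetric inner s"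
    using assms by simp
next
  assume *: "hmetric q s > \<eta> * hmetric inner s"
  show "\<forall>t\<in>cline s - {0}. hmetric q t > \<eta> * hmetric inner t"
  proof
    fix t assume "t \<in> cline s - {0}"
    then obtain c where c: "t = c *s s" "c \<noteq> 0"
      by (auto simp: mem_cline_iff)
    have "(cmod c)\<^sup>2 * (\<eta> * hmetric inner s) < (cmod c)\<^sup>2 * hmetric q s"
      using * c(2) by (intro mult_strict_left_mono) auto
    then show "hmetric q t > \<eta> * hmetric inner t"
      unfolding c(1) hmetric_scale[OF bil sym] hmetric_scale[OF bilinear_inner inner_commute]
      by (simp add: mult.left_commute)
  qed
qed

lemma cline_in_exhaustion_iff:
  assumes "s \<noteq> 0"
  shows "cline s \<in> exhaustion q \<eta> \<longleftrightarrow> cline s \<in> period_domain q \<and> hmetric q s > \<eta> * hmetric inner s"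
  unfolding exhaustion_def using hmetric_bound_cline[OF assms] by simp

lemma tline_in_PT_exhaustion_iff:
  assumes "(s, v) \<in> tangent_pairs q"
  shows "tline s v \<in> PT_exhaustion q \<eta> \<longleftrightarrow> tline s v \<in> PT_plus q \<and> hmetric q s > \<eta> * hmetric inner s"
proof -
  have s: "s \<noteq> 0" "cline s \<in> period_domain q"
    using assms by (auto simp: tangent_pairs_def)
  have "cline s' = cline s" if "tline s v = tline s' v'" for s' v'
    using tline_eq_imp_cline_eq[OF that s(1)] by simp
  then have "(\<forall>s' v'. (s', v') \<in> tangent_pairs q \<and> tline s v = tline s' v' \<longrightarrow> cline s' \<in> exhaustion q \<eta>)
     \<longleftrightarrow> cline s \<in> exhaustion q \<eta>"
    using assms by metis
  then show ?thesis
    unfolding PT_exhaustion_def using cline_in_exhaustion_iff[OF s(1)] s(2) by simp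
qed

lemma openin_exhaustion: "openin (period_topology q) (exhaustion q \<eta>)"
proof -
  \<comment> \<open>Only the strict inequality, whose preimage is open, goes into \<open>T\<close>;
    the closed condition q (s, s) = 0 enters by intersecting with
    \<open>period_domain q\<close>.\<close>
  define T where "T = {\<sigma> \<in> proj_space. \<forall>s\<in>\<sigma> - {0}. hmetric q s > \<eta> * hmetric inner s}"
  have "openin proj_topology T"
    unfolding proj_topology_def openin_quotient_topology
  proof
    show "T \<subseteq> cline ` topspace (top_of_set (UNIV - {0}))"
      by (auto simp: T_def proj_space_def)
    have eq: "{s \<in> topspace (top_of_set (UNIV - {0})). cline s \<in> T} =
        (UNIV - {0}) \<inter> {s. \<eta> * hmetric inner s < hmetric q s}"
    proof -
      have "cline s \<in> T \<longleftrightarrow> \<eta> * hmetric inner s < hmetric q s" if "s \<noteq> 0" for s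
        using that hmetric_bound_cline[OF that, of \<eta>] by (auto simp: T_def proj_space_def)
      then show ?thesis by auto
    qed
    have "open {s. \<eta> * hmetric inner s < hmetric q s}"
      by (intro open_Collect_less continuous_intros continuous_on_hmetric bil sym
          bilinear_inner inner_commute)
    then show "openin (top_of_set (UNIV - {0})) {s \<in> topspace (top_of_set (UNIV - {0})). cline s \<in> T}"
      unfolding eq by (rule openin_open_Int)
  qed
  moreover have "exhaustion q \<eta> = T \<inter> period_domain q"
    by (auto simp: exhaustion_def T_def period_domain_def)
  ultimately show ?thesis
    unfolding period_topology_def openin_subtopology by blast
qed

lemma openin_PT_exhaustion: "openin (subtopology (PT_topology q) (PT_plus q)) (PT_exhaustion q \<eta>)"
proof -
  let ?\<pi> = "\<lambda>(s, v). tline s v :: 'n tangent set"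
  let ?B = "{p :: (complex^'n) \<times> (complex^'n). \<eta> * hmetric inner (fst p) < hmetric q (fst p)}"
  define T where "T = ?\<pi> ` (tangent_pairs q \<inter> ?B)"
  \<comment> \<open>\<open>T\<close> is an image; its preimage is again cut out by the inequality
    because that depends on the base line alone.\<close>
  have T_iff: "tline s v \<in> T \<longleftrightarrow> \<eta> * hmetric inner s < hmetric q s" if sv: "(s, v) \<in> tangent_pairs q" for s v
  proof
    assume "tline s v \<in> T"
    then obtain s' v' where s': "(s', v') \<in> tangent_pairs q" "\<eta> * hmetric inner s' < hmetric q s'"
        "tline s v = tline s' v'"
      by (auto simp: T_def)
    have nz: "s \<noteq> 0" "s' \<noteq> 0"
      using sv s'(1) by (auto simp: tangent_pairs_def)
    have "cline s = cline s'"
      using tline_eq_imp_cline_eq[OF s'(3) nz(1)] .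
    then show "\<eta> * hmetric inner s < hmetric q s"
      using s'(2) hmetric_bound_cline[OF nz(1), of \<eta>] hmetric_bound_cline[OF nz(2), of \<eta>] by simp
  qed (use sv in \<open>auto simp: T_def\<close>)
  have "openin (PT_topology q) T"
    unfolding PT_topology_def openin_quotient_topology
  proof
    show "T \<subseteq> ?\<pi> ` topspace (top_of_set (tangent_pairs q))"
      by (auto simp: T_def)
    have eq: "{p \<in> topspace (top_of_set (tangent_pairs q)). ?\<pi> p \<in> T} = tangent_pairs q \<inter> ?B"
      using T_iff by auto
    have "continuous_on UNIV (\<lambda>p::(complex^'n) \<times> (complex^'n). hmetric q (fst p))"
      "continuous_on UNIV (\<lambda>p::(complex^'n) \<times> (complex^'n). hmetric inner (fst p))"
      using continuous_on_compose[OF continuous_on_fst[OF continuous_on_id] continuous_on_hmetric[OF bil sym]]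
        continuous_on_compose[OF continuous_on_fst[OF continuous_on_id]
          continuous_on_hmetric[OF bilinear_inner inner_commute]]
      by (simp_all add: o_def)
    then have "open ?B"
      by (intro open_Collect_less continuous_intros)
    then show "openin (top_of_set (tangent_pairs q)) {p \<in> topspace (top_of_set (tangent_pairs q)). ?\<pi> p \<in> T}"
      unfolding eq by (rule openin_open_Int)
  qed
  moreover have "PT_exhaustion q \<eta> = T \<inter> PT_plus q"
  proof (intro set_eqI)
    fix l
    show "l \<in> PT_exhaustion q \<eta> \<longleftrightarrow> l \<in> T \<inter> PT_plus q"
    proof (cases "l \<in> PT q")
      case True
      then obtain s v where "l = tline s v" "(s, v) \<in> tangent_pairs q"
        by (auto simp: PT_def)
      then show ?thesis
        using T_iff[of s v] tline_in_PT_exhaustion_iff[of s v] by auto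
    qed (auto simp: PT_exhaustion_def PT_plus_def)
  qed
  ultimately show ?thesis
    unfolding openin_subtopology by blast
qed

lemma hmetric_pos_imp_bound:
  assumes "s \<noteq> 0" "hmetric q s > 0"
  shows "\<exists>\<eta>>0. hmetric q s > \<eta> * hmetric inner s"
  using assms hmetric_inner_pos[OF assms(1)]
  \<comment> \<open>Half of the scale-invariant ratio makes the inequality strict.\<close>
  by (intro exI[of _ "hmetric q s / (2 * hmetric inner s)"]) simp

lemma Union_exhaustion: "(\<Union>\<eta>\<in>{0<..}. exhaustion q \<eta>) = period_domain q"
proof
  show "period_domain q \<subseteq> (\<Union>\<eta>\<in>{0<..}. exhaustion q \<eta>)"
  proof
    fix \<sigma> assume \<sigma>: "\<sigma> \<in> period_domain q"
    then obtain s where s: "s \<noteq> 0" "\<sigma> = cline s"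
      by (auto simp: period_domain_def proj_space_def)
    then obtain \<eta> where "\<eta> > 0" "hmetric q s > \<eta> * hmetric inner s"
      using hmetric_pos_imp_bound[OF s(1)] period_domain_cext_hmetric(2)[of s q] \<sigma> by blast
    then show "\<sigma> \<in> (\<Union>\<eta>\<in>{0<..}. exhaustion q \<eta>)"
      using s \<sigma> cline_in_exhaustion_iff by auto
  qed
qed (auto simp: exhaustion_def)

lemma Union_PT_exhaustion: "(\<Union>\<eta>\<in>{0<..}. PT_exhaustion q \<eta>) = PT_plus q"
proof
  show "PT_plus q \<subseteq> (\<Union>\<eta>\<in>{0<..}. PT_exhaustion q \<eta>)"
  proof
    fix l assume l: "l \<in> PT_plus q"
    then obtain s v where s: "l = tline s v" "(s, v) \<in> tangent_pairs q"
      by (auto simp: PT_plus_def PT_def)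
    then have "s \<noteq> 0" "cline s \<in> period_domain q"
      by (auto simp: tangent_pairs_def)
    then obtain \<eta> where "\<eta> > 0" "hmetric q s > \<eta> * hmetric inner s"
      using hmetric_pos_imp_bound period_domain_cext_hmetric(2) by blast
    then show "l \<in> (\<Union>\<eta>\<in>{0<..}. PT_exhaustion q \<eta>)"
      using s l tline_in_PT_exhaustion_iff by auto
  qed
qed (auto simp: PT_exhaustion_def)

lemma exhaustion_antimono:
  assumes "\<beta> \<le> \<alpha>"
  shows "exhaustion q \<alpha> \<subseteq> exhaustion q \<beta>"
proof
  fix \<sigma> assume \<sigma>: "\<sigma> \<in> exhaustion q \<alpha>"
  have "\<beta> * hmetric inner s < hmetric q s" if "s \<in> \<sigma> - {0}" for s
  proof -
    have "\<beta> * hmetric inner s \<le> \<alpha> * hmetric inner s"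
      using assms hmetric_inner_pos[of s] that by (intro mult_right_mono) auto
    also have "\<dots> < hmetric q s"
      using \<sigma> that by (simp add: exhaustion_def)
    finally show ?thesis .
  qed
  then show "\<sigma> \<in> exhaustion q \<beta>"
    using \<sigma> by (simp add: exhaustion_def)
qed

lemma PT_exhaustion_antimono: "\<beta> \<le> \<alpha> \<Longrightarrow> PT_exhaustion q \<alpha> \<subseteq> PT_exhaustion q \<beta>"
  using exhaustion_antimono unfolding PT_exhaustion_def by blast

lemma curve_leaves_exhaustions:
  assumes f: "entire_curve q f" "\<not> f constant_on UNIV" "GS_pullback_nonneg q f" and \<epsilon>: "\<epsilon> > 0"
  obtains x where "f x \<notin> exhaustion q \<epsilon>" "curve_lift q f x \<notin> PT_exhaustion q \<epsilon>"
proof -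
  have "\<not> (\<forall>x. f x \<in> exhaustion q \<epsilon>)"
  proof
    assume "\<forall>x. f x \<in> exhaustion q \<epsilon>"
    then have "\<epsilon> * hmetric inner s < hmetric q s" if "s \<in> f x - {0}" for x s
      using that by (auto simp: exhaustion_def)
    with curve_constant_if_hmetric_bounded_below[OF bil sym f(1,3) \<epsilon>] f(2) show False
      by blast
  qed
  then obtain x where x: "f x \<notin> exhaustion q \<epsilon>"
    by blast
  obtain s v where s: "(s, v) \<in> tangent_pairs q" "f x = cline s" "curve_lift q f x = tline s v"
    by (rule curve_lift_eq[OF bil sym f(1,2), where x = x])
  \<comment> \<open>The lifted line has base point \<open>f x\<close>, so its membership would put
    \<open>f x\<close> back into \<open>exhaustion q \<epsilon>\<close>.\<close>
  then have "curve_lift q f x \<notin> PT_exhaustion q \<epsilon>"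
    using x unfolding PT_exhaustion_def by auto
  with x that show ?thesis
    by blast
qed

end

theorem theorem1p5:
  fixes q :: "real^'n \<Rightarrow> real^'n \<Rightarrow> real" and p :: nat
  assumes "bilinear q"
    and "\<And>x y. q x y = q y x"
    and "nondegenerate q"
    and "has_signature q 3 p"
  shows "\<exists>(D\<^sub>0 :: real \<Rightarrow> (complex^'n) set set) (D\<^sub>1 :: real \<Rightarrow> 'n tangent set set).
     (\<forall>\<eta>>0. openin (period_topology q) (D\<^sub>0 \<eta>) \<and>
            openin (subtopology (PT_topology q) (PT_plus q)) (D\<^sub>1 \<eta>)) \<and>
     (\<forall>\<alpha> \<beta>. 0 < \<beta> \<and> \<beta> < \<alpha> \<longrightarrow> D\<^sub>0 \<alpha> \<subseteq> D\<^sub>0 \<beta> \<and> D\<^sub>1 \<alpha> \<subseteq> D\<^sub>1 \<beta>) \<and>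
     (\<Union>\<eta>\<in>{0<..}. D\<^sub>0 \<eta>) = period_domain q \<and>
     (\<Union>\<eta>\<in>{0<..}. D\<^sub>1 \<eta>) = PT_plus q \<and>
     (\<forall>f. entire_curve q f \<and> \<not> f constant_on UNIV \<and> GS_pullback_nonneg q f \<longrightarrow>
        (\<forall>\<epsilon>>0. \<exists>x\<^sub>0 x\<^sub>1. f x\<^sub>0 \<notin> D\<^sub>0 \<epsilon> \<and> curve_lift q f x\<^sub>1 \<notin> D\<^sub>1 \<epsilon>))"
proof (intro exI[of _ "exhaustion q"] exI[of _ "PT_exhaustion q"] conjI allI impI)
  fix f :: "complex \<Rightarrow> (complex^'n) set" and \<epsilon> :: real
  assume "entire_curve q f \<and> \<not> f constant_on UNIV \<and> GS_pullback_nonneg q f" "0 < \<epsilon>"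
  then show "\<exists>x\<^sub>0 x\<^sub>1. f x\<^sub>0 \<notin> exhaustion q \<epsilon> \<and> curve_lift q f x\<^sub>1 \<notin> PT_exhaustion q \<epsilon>"
    using curve_leaves_exhaustions[OF assms(1,2)] by metis
next
  fix \<alpha> \<beta> :: real
  assume "0 < \<beta> \<and> \<beta> < \<alpha>"
  then show "exhaustion q \<alpha> \<subseteq> exhaustion q \<beta>" "PT_exhaustion q \<alpha> \<subseteq> PT_exhaustion q \<beta>"
    by (simp_all add: exhaustion_antimono[OF assms(1,2)] PT_exhaustion_antimono[OF assms(1,2)])
qed (use openin_exhaustion[OF assms(1,2)] openin_PT_exhaustion[OF assms(1,2)]
    Union_exhaustion[OF assms(1,2)] Union_PT_exhaustion[OF assms(1,2)] in simp_all)

end
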